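(* Every outerplanar graph has layered pathwidth at most $2$.
   Context: Graphs are finite, simple and undirected. A path decomposition of a graph is a sequence of vertex subsets (bags) such that each vertex belongs to a nonempty contiguous subsequence of bags and every two adjacent vertices have at least one bag in common. A layering of a graph is a partition of its vertices into a sequence of disjoint subsets (layers) such that each edge joins vertices in the same layer or in consecutive layers. The layered pathwidth of a graph $G$ is the minimum integer $k$ such that for some path decomposition and some layering of $G$, the intersection of each bag with each layer has at most $k$ vertices. *)

theory Defs
  imports
    "HOL-Analysis.Analysis"
    "Graph_Theory.Pair_Digraph"
    "HOL-Library.Disjoint_Sets"
begin

text \<open>
  Finite simple undirected graphs are represented by \<^locale>\<open>pair_graph\<close>, that is, as finite
  symmetric loop-free digraphs; every undirected edge occurs there as two opposite arcs.
\<close>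

definition edges :: "'a pair_pre_digraph \<Rightarrow> 'a set set" where
  "edges G = {{u, v} | u v. (u, v) \<in> parcs G}"

definition path_decomposition :: "'a pair_pre_digraph \<Rightarrow> 'a set list \<Rightarrow> bool" where
  "path_decomposition G Bs \<longleftrightarrow>
     (\<forall>B \<in> set Bs. B \<subseteq> pverts G) \<and>
     (\<forall>v \<in> pverts G. \<exists>i j. i \<le> j \<and> j < length Bs \<and>
        {t. t < length Bs \<and> v \<in> Bs ! t} = {i..j}) \<and>
     (\<forall>e \<in> edges G. \<exists>B \<in> set Bs. e \<subseteq> B)"

definition layering :: "'a pair_pre_digraph \<Rightarrow> 'a set list \<Rightarrow> bool" where
  "layering G Ls \<longleftrightarrow>
     partition_on (pverts G) (set Ls) \<and> distinct Ls \<and>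
     (\<forall>u v i j. {u, v} \<in> edges G \<longrightarrow> i < length Ls \<longrightarrow> j < length Ls \<longrightarrow>
        u \<in> Ls ! i \<longrightarrow> v \<in> Ls ! j \<longrightarrow> i \<le> Suc j \<and> j \<le> Suc i)"

text \<open>
  For a finite graph the set of admissible \<open>k\<close> is never empty: put all the vertices into a
  single bag and a single layer.
\<close>

definition layered_pathwidth :: "'a pair_pre_digraph \<Rightarrow> nat" where
  "layered_pathwidth G =
     (LEAST k. \<exists>Bs Ls. path_decomposition G Bs \<and> layering G Ls \<and>
        (\<forall>B \<in> set Bs. \<forall>L \<in> set Ls. card (B \<inter> L) \<le> k))"

text \<open>
  A drawing without crossings in the plane, here \<^typ>\<open>complex\<close>: \<open>p\<close> places the vertices and
  \<open>\<gamma> e\<close> is the simple curve that represents the edge \<open>e\<close>. Its direction is immaterial.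
\<close>

definition plane_drawing ::
  "'a pair_pre_digraph \<Rightarrow> ('a \<Rightarrow> complex) \<Rightarrow> ('a set \<Rightarrow> real \<Rightarrow> complex) \<Rightarrow> bool" where
  "plane_drawing G p \<gamma> \<longleftrightarrow>
     inj_on p (pverts G) \<and>
     (\<forall>e \<in> edges G. arc (\<gamma> e) \<and>
        {pathstart (\<gamma> e), pathfinish (\<gamma> e)} = p ` e \<and>
        path_image (\<gamma> e) \<inter> p ` pverts G = p ` e) \<and>
     (\<forall>e \<in> edges G. \<forall>f \<in> edges G. e \<noteq> f \<longrightarrow>
        path_image (\<gamma> e) \<inter> path_image (\<gamma> f) = p ` (e \<inter> f))"

definition drawing_points ::
  "'a pair_pre_digraph \<Rightarrow> ('a \<Rightarrow> complex) \<Rightarrow> ('a set \<Rightarrow> real \<Rightarrow> complex) \<Rightarrow> complex set" where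
  "drawing_points G p \<gamma> = p ` pverts G \<union> (\<Union>e \<in> edges G. path_image (\<gamma> e))"

text \<open>
  A graph is outerplanar if it has a crossing-free drawing with every vertex incident to the
  outer face. As the drawing of a finite graph is compact, its outer face (the unbounded
  component of the complement) is \<^const>\<open>outside\<close>; a vertex is incident to a face when it lies on
  the boundary of that face.
\<close>

definition outerplanar :: "'a pair_pre_digraph \<Rightarrow> bool" where
  "outerplanar G \<longleftrightarrow>
     (\<exists>p \<gamma>. plane_drawing G p \<gamma> \<and> p ` pverts G \<subseteq> frontier (outside (drawing_points G p \<gamma>)))"

end

theory Submission
  imports Defs
begin

text \<open>
  Call two edges \<open>ac\<close> and \<open>bd\<close> crossing in a linear order of the vertices if \<open>a < b < c < d\<close>. The
  proof first turns the drawing into a linear order without crossing edges, and then reads a layering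
  and a path decomposition off that order.

  The topology enters through one fact about theta curves: of three arcs that share exactly their
  two ends, one runs inside the closed curve formed by the other two (\<open>theta_arc_inside\<close>). In an
  outerplane drawing no vertex lies inside a closed curve of the drawing. Hence there are no three
  internally disjoint paths with common ends that all have inner vertices
  (\<open>no_three_paths\<close>), and no cycle has two crossing chords (\<open>no_crossing_chords\<close>): both chords would
  run inside the cycle, the first cuts the inside into two parts, and the second, confined to
  one part, cannot reach both of its ends.

  These two exclusions give the order by induction on induced subgraphs. At a vertex whose removal
  separates the rest, the orders of the two sides are rotated to start at that vertex and are
  concatenated. If there is no such vertex, a longest cycle is Hamiltonian, because a path through
  a missed vertex either lengthens the cycle or yields three paths as above; the order along a
  Hamiltonian cycle is noncrossing, because crossing edges are crossing chords.

  For the decomposition, let the vertices be \<open>0, ..., n - 1\<close> in a noncrossing order. The interval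
  \<open>[x, y]\<close> is subdivided at the neighbours of \<open>x\<close> and \<open>y\<close> strictly between them, together with
  \<open>x + 1\<close> and \<open>y - 1\<close>. No edge strictly inside \<open>[x, y]\<close> jumps over such a point, so it stays in one of
  the parts between consecutive points, and these parts are subdivided in turn. Starting from
  \<open>[0, n - 1]\<close> one obtains nested intervals. Each vertex is an end of intervals of one depth only, and
  this depth is its layer. The bag of a position \<open>t\<close> consists of the ends of all intervals around \<open>t\<close>;
  since only one of them has any given depth, a bag has at most two vertices in a layer.
\<close>

section \<open>Theta curves in the plane\<close>

lemma Jordan_two_arcs:
  fixes c1 c2 :: "real \<Rightarrow> complex"
  assumes "arc c1" "pathstart c1 = a" "pathfinish c1 = b"
      and "arc c2" "pathstart c2 = a" "pathfinish c2 = b"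
      and "path_image c1 \<inter> path_image c2 = {a, b}"
  defines "J \<equiv> path_image c1 \<union> path_image c2"
  shows "inside J \<noteq> {}" "connected (inside J)" "connected (outside J)" "frontier (inside J) = J"
proof -
  have sp: "simple_path (c1 +++ reversepath c2)"
    using assms by (auto simp: simple_path_join_loop_eq arc_reversepath)
  have "path_image (c1 +++ reversepath c2) = J"
    using assms by (simp add: path_image_join)
  moreover have "pathfinish (c1 +++ reversepath c2) = pathstart (c1 +++ reversepath c2)"
    using assms by simp
  ultimately show "inside J \<noteq> {}" "connected (inside J)" "connected (outside J)"
      "frontier (inside J) = J"
    using Jordan_inside_outside[OF sp] by auto
qed

lemma connected_subset_inside_or_outside:
  fixes C S :: "'a :: real_normed_vector set"
  assumes "connected C" "C \<inter> S = {}"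
  shows "C \<subseteq> inside S \<or> C \<subseteq> outside S"
proof (cases "C \<inter> inside S = {}")
  case True
  then show ?thesis
    using assms inside_Un_outside[of S] by blast
next
  case False
  then obtain x where x: "x \<in> C" "x \<in> inside S"
    by blast
  have "y \<in> inside S" if "y \<in> C" for y
  proof (rule inside_same_component[OF _ x(2)])
    show "connected_component (- S) x y"
      unfolding connected_component_def using assms x that by blast
  qed
  then show ?thesis
    by blast
qed

text \<open>Otherwise \<open>{v}\<close> would be relatively clopen in \<open>S\<close>.\<close>

lemma connected_diff_ends_closure:
  fixes S :: "complex set"
  assumes "connected S" "u \<in> S" "v \<in> S" "u \<noteq> v"
  shows "v \<in> closure (S - {u, v})"
proof (rule ccontr)
  assume "v \<notin> closure (S - {u, v})"
  then have "(insert u (closure (S - {u, v}))) \<inter> {v} \<inter> S = {}"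
    using assms(4) by auto
  moreover have "S \<subseteq> (insert u (closure (S - {u, v}))) \<union> {v}"
    using closure_subset[of "S - {u, v}"] by blast
  ultimately show False
    using connected_closedD[OF assms(1), of "insert u (closure (S - {u, v}))" "{v}"] assms(2,3)
    by (auto simp: closed_insert)
qed

text \<open>
  The open arc of each \<open>ci\<close> is connected, so it is inside or outside the curve formed by the other
  two. Suppose that all three are outside. Then the insides of the three Jordan curves are
  different components of the complement of the theta curve, and a point inside \<open>c1 \<union> c2\<close> is
  outside \<open>c1 \<union> c3\<close> and \<open>c2 \<union> c3\<close>. As these two sets meet in the connected set \<open>c3\<close>, Janiszewski's
  theorem joins the point to infinity in the complement of the whole theta curve, although it is
  inside \<open>c1 \<union> c2\<close>.
\<close>

lemma theta_arc_inside:
  fixes c1 c2 c3 :: "real \<Rightarrow> complex"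
  assumes c1: "arc c1" "pathstart c1 = a" "pathfinish c1 = b"
      and c2: "arc c2" "pathstart c2 = a" "pathfinish c2 = b"
      and c3: "arc c3" "pathstart c3 = a" "pathfinish c3 = b"
      and i12: "path_image c1 \<inter> path_image c2 = {a, b}"
      and i13: "path_image c1 \<inter> path_image c3 = {a, b}"
      and i23: "path_image c2 \<inter> path_image c3 = {a, b}"
  shows "path_image c1 - {a, b} \<subseteq> inside (path_image c2 \<union> path_image c3) \<or>
         path_image c2 - {a, b} \<subseteq> inside (path_image c1 \<union> path_image c3) \<or>
         path_image c3 - {a, b} \<subseteq> inside (path_image c1 \<union> path_image c2)"
proof (rule ccontr)
  assume contra: "\<not> ?thesis"
  let ?P1 = "path_image c1" let ?P2 = "path_image c2" let ?P3 = "path_image c3"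
  note J12 = Jordan_two_arcs[OF c1 c2 i12] and J13 = Jordan_two_arcs[OF c1 c3 i13]
    and J23 = Jordan_two_arcs[OF c2 c3 i23]
  have out: "path_image c - {a, b} \<subseteq> outside S"
    if "arc c" "pathstart c = a" "pathfinish c = b" "path_image c \<inter> S = {a, b}"
       "\<not> path_image c - {a, b} \<subseteq> inside S" for c :: "real \<Rightarrow> complex" and S
  proof -
    have "connected (path_image c - {a, b})"
      using connected_simple_path_endless[of c] that arc_imp_simple_path by auto
    moreover have "(path_image c - {a, b}) \<inter> S = {}"
      using that by blast
    ultimately show ?thesis
      using connected_subset_inside_or_outside that(5) by blast
  qed
  have o1: "?P1 - {a, b} \<subseteq> outside (?P2 \<union> ?P3)"
    proof (rule out[OF c1])
    show "?P1 \<inter> (?P2 \<union> ?P3) = {a, b}"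
      using i12 i13 by blast
  qed (use contra in blast)
  have o2: "?P2 - {a, b} \<subseteq> outside (?P1 \<union> ?P3)"
    proof (rule out[OF c2])
    show "?P2 \<inter> (?P1 \<union> ?P3) = {a, b}"
      using i12 i23 by blast
  qed (use contra in blast)
  have o3: "?P3 - {a, b} \<subseteq> outside (?P1 \<union> ?P2)"
    proof (rule out[OF c3])
    show "?P3 \<inter> (?P1 \<union> ?P2) = {a, b}"
      using i13 i23 by blast
  qed (use contra in blast)
  have abP: "{a, b} \<subseteq> ?P1" "{a, b} \<subseteq> ?P2" "{a, b} \<subseteq> ?P3"
    using i12 i13 by blast+
  have disj: "X \<inter> P = {}" if "X \<inter> S = {}" "X \<inter> U = {}" "P - {a, b} \<subseteq> U" "{a, b} \<subseteq> S"
    for X P S U :: "complex set"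
    using that by blast
  have d12: "inside (?P1 \<union> ?P2) \<inter> ?P3 = {}"
    by (rule disj[OF inside_no_overlap inside_Int_outside o3]) (use abP in simp)
  have d13: "inside (?P1 \<union> ?P3) \<inter> ?P2 = {}"
    by (rule disj[OF inside_no_overlap inside_Int_outside o2]) (use abP in simp)
  have d23: "inside (?P2 \<union> ?P3) \<inter> ?P1 = {}"
    by (rule disj[OF inside_no_overlap inside_Int_outside o1]) (use abP in simp)
  have inner: "\<exists>z. z \<in> path_image c \<and> z \<notin> {a, b}" if "arc c" "pathstart c = a" "pathfinish c = b"
    for c :: "real \<Rightarrow> complex"
  proof -
    have "c (1/2) \<noteq> c 0" "c (1/2) \<noteq> c 1"
      using that(1) inj_onD[of c "{0..1}" "1/2" 0] inj_onD[of c "{0..1}" "1/2" 1]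
      by (auto simp: arc_def)
    then show ?thesis
      using that(2,3) by (auto simp: path_image_def pathstart_def pathfinish_def)
  qed
  \<comment> \<open>Overlapping insides coincide when neither curve enters the inside of the other.\<close>
  have inside_eq: "inside S = inside T"
    if "connected (inside S)" "connected (inside T)" "x \<in> inside S" "x \<in> inside T"
       "inside S \<inter> T = {}" "inside T \<inter> S = {}" for S T :: "complex set" and x
  proof (rule antisym)
    show "inside S \<subseteq> inside T"
      using connected_subset_inside_or_outside[OF that(1,5)] that(3,4) inside_Int_outside[of T]
      by blast
    show "inside T \<subseteq> inside S"
      using connected_subset_inside_or_outside[OF that(2,6)] that(3,4) inside_Int_outside[of S]
      by blast
  qed
  obtain x where x: "x \<in> inside (?P1 \<union> ?P2)"
    using J12(1) by blast
  have x13: "x \<in> outside (?P1 \<union> ?P3)"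
  proof -
    have "x \<notin> inside (?P1 \<union> ?P3)"
    proof
      assume "x \<in> inside (?P1 \<union> ?P3)"
      then have "inside (?P1 \<union> ?P2) = inside (?P1 \<union> ?P3)"
        using inside_eq[OF J12(2) J13(2) x] d12 d13 inside_no_overlap[of "?P1 \<union> ?P2"]
          inside_no_overlap[of "?P1 \<union> ?P3"] by (simp add: Int_Un_distrib)
      then have "?P1 \<union> ?P2 = ?P1 \<union> ?P3"
        using J12(4) J13(4) by metis
      then show False
        using inner[OF c2] i12 i23 by blast
    qed
    then show ?thesis
      using x d12 inside_no_overlap[of "?P1 \<union> ?P2"] inside_Un_outside[of "?P1 \<union> ?P3"] by blast
  qed
  have x23: "x \<in> outside (?P2 \<union> ?P3)"
  proof -
    have "x \<notin> inside (?P2 \<union> ?P3)"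
    proof
      assume "x \<in> inside (?P2 \<union> ?P3)"
      then have "inside (?P1 \<union> ?P2) = inside (?P2 \<union> ?P3)"
        using inside_eq[OF J12(2) J23(2) x] d12 d23 inside_no_overlap[of "?P1 \<union> ?P2"]
          inside_no_overlap[of "?P2 \<union> ?P3"] by (simp add: Int_Un_distrib)
      then have "?P1 \<union> ?P2 = ?P2 \<union> ?P3"
        using J12(4) J23(4) by metis
      then show False
        using inner[OF c1] i12 i13 by blast
    qed
    then show ?thesis
      using x d12 inside_no_overlap[of "?P1 \<union> ?P2"] inside_Un_outside[of "?P2 \<union> ?P3"] by blast
  qed
  have comp: "compact ?P1" "compact ?P2" "compact ?P3"
    using c1(1) c2(1) c3(1) by (simp_all add: arc_def compact_path_image)
  then have "bounded (?P1 \<union> ?P2 \<union> ?P3)"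
    by (simp add: compact_imp_bounded)
  \<comment> \<open>The point \<open>y\<close> stands for infinity.\<close>
  then obtain y where y: "y \<in> outside (?P1 \<union> ?P2 \<union> ?P3)"
    using outside_bounded_nonempty by blast
  have y12: "y \<in> outside (?P1 \<union> ?P2)" and y13: "y \<in> outside (?P1 \<union> ?P3)"
    and y23: "y \<in> outside (?P2 \<union> ?P3)"
    using y outside_mono[of "?P1 \<union> ?P2" "?P1 \<union> ?P2 \<union> ?P3"]
      outside_mono[of "?P1 \<union> ?P3" "?P1 \<union> ?P2 \<union> ?P3"]
      outside_mono[of "?P2 \<union> ?P3" "?P1 \<union> ?P2 \<union> ?P3"] by blast+
  have "connected_component (- ((?P1 \<union> ?P3) \<union> (?P2 \<union> ?P3))) x y"
  proof (rule Janiszewski)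
    show "compact (?P1 \<union> ?P3)" "closed (?P2 \<union> ?P3)"
      using comp by (auto intro: compact_Un compact_imp_closed)
    have "(?P1 \<union> ?P3) \<inter> (?P2 \<union> ?P3) = ?P3"
      using i12 abP by blast
    then show "connected ((?P1 \<union> ?P3) \<inter> (?P2 \<union> ?P3))"
      using c3(1) by (simp add: arc_def connected_path_image)
    show "connected_component (- (?P1 \<union> ?P3)) x y"
      unfolding connected_component_def
      using J13(3) x13 y13 outside_no_overlap[of "?P1 \<union> ?P3"] by blast
    show "connected_component (- (?P2 \<union> ?P3)) x y"
      unfolding connected_component_def
      using J23(3) x23 y23 outside_no_overlap[of "?P2 \<union> ?P3"] by blast
  qed
  then have "connected_component (- (?P1 \<union> ?P2)) x y"
    by (rule connected_component_of_subset) blast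
  then have "y \<in> inside (?P1 \<union> ?P2)"
    using x by (rule inside_same_component)
  then show False
    using y12 inside_Int_outside[of "?P1 \<union> ?P2"] by blast
qed

section \<open>Paths in an outerplane drawing\<close>

fun path_edges :: "'a list \<Rightarrow> 'a set set" where
  "path_edges (x # y # zs) = insert {x, y} (path_edges (y # zs))"
| "path_edges _ = {}"

lemma path_edges_subset: "e \<in> path_edges xs \<Longrightarrow> e \<subseteq> set xs"
proof (induction xs rule: path_edges.induct)
qed auto

lemma path_edges_append: "path_edges (xs @ y # ys) = path_edges (xs @ [y]) \<union> path_edges (y # ys)"
proof (induction xs rule: path_edges.induct)
  case ("2_2" v)
  then show ?case
    by (cases ys) auto
qed auto

lemma path_edges_rev: "path_edges (rev xs) = path_edges xs"
proof (induction xs rule: path_edges.induct)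
  case (1 x y zs)
  have "path_edges (rev (x # y # zs)) = path_edges (rev zs @ [y]) \<union> path_edges [y, x]"
    using path_edges_append[of "rev zs" y "[x]"] by simp
  then show ?case
    using 1 by auto
qed auto

text \<open>
  Used to see that paths with disjoint interiors share no edge, unless both consist of a single
  edge.
\<close>

lemma path_edges_meet_interior:
  assumes "e \<in> path_edges (x # q @ [y])" "q \<noteq> []"
  shows "e \<inter> set q \<noteq> {}"
proof -
  have "f \<inter> set r \<noteq> {}" if "f \<in> path_edges (r @ [y])" "r \<noteq> []" for f r
    using that by (induction r rule: path_edges.induct) auto
  from this[of e q] show ?thesis
    using assms by (cases q) auto
qed

lemma path_edges_cover: "length xs \<ge> 2 \<Longrightarrow> v \<in> set xs \<Longrightarrow> \<exists>e \<in> path_edges xs. v \<in> e"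
proof (induction xs rule: path_edges.induct)
  case (1 x y zs)
  then show ?case
    by (cases zs) auto
qed auto

text \<open>
  Paths are represented combinatorially, by vertex lists that satisfy \<open>successively adj\<close>. The link
  to the topology is \<open>path_arc\<close>: if such a list is distinct, the point set \<open>drawn vs\<close> of its edges
  is an arc between the end vertices.
\<close>

locale outerplane_drawing =
  fixes G :: "'a pair_pre_digraph" and p :: "'a \<Rightarrow> complex" and \<gamma> :: "'a set \<Rightarrow> real \<Rightarrow> complex"
  assumes graph: "pair_graph G"
    and drawing: "plane_drawing G p \<gamma>"
    and outer: "p ` pverts G \<subseteq> frontier (outside (drawing_points G p \<gamma>))"
begin

abbreviation adj :: "'a \<Rightarrow> 'a \<Rightarrow> bool" where
  "adj u v \<equiv> (u, v) \<in> parcs G"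

definition drawn :: "'a list \<Rightarrow> complex set" where
  "drawn vs = (\<Union>e \<in> path_edges vs. path_image (\<gamma> e))"

lemma adj_sym: "adj u v \<Longrightarrow> adj v u"
proof -
  interpret pair_graph G by (rule graph)
  show "adj u v \<Longrightarrow> adj v u"
    using pair_sym_arcs by (auto simp: symmetric_def dest: symD)
qed

lemma successively_adj_rev: "successively adj vs \<Longrightarrow> successively adj (rev vs)"
  unfolding successively_rev by (erule successively_mono) (rule adj_sym)

lemma adj_irrefl: "\<not> adj v v"
proof -
  interpret pair_graph G by (rule graph)
  show ?thesis
    using pair_no_loops by fastforce
qed

lemma adj_verts: "adj u v \<Longrightarrow> u \<in> pverts G \<and> v \<in> pverts G"
proof -
  interpret pair_graph G by (rule graph)
  show "adj u v \<Longrightarrow> u \<in> pverts G \<and> v \<in> pverts G"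
    using in_arcsD1 in_arcsD2 by blast
qed

lemma finite_verts: "finite (pverts G)"
proof -
  interpret pair_graph G by (rule graph)
  show ?thesis
    by (rule pair_finite_verts)
qed

lemma edge_ends:
  assumes "e \<in> edges G"
  shows "{pathstart (\<gamma> e), pathfinish (\<gamma> e)} = p ` e"
  using drawing assms unfolding plane_drawing_def by blast

lemma edge_vertices:
  assumes "e \<in> edges G"
  shows "path_image (\<gamma> e) \<inter> p ` pverts G = p ` e"
  using drawing assms unfolding plane_drawing_def by blast

lemma edges_Int:
  assumes "e \<in> edges G" "f \<in> edges G" "e \<noteq> f"
  shows "path_image (\<gamma> e) \<inter> path_image (\<gamma> f) = p ` (e \<inter> f)"
  using drawing assms unfolding plane_drawing_def by blast

lemma edge_drawing:
  assumes "adj u v"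
  shows "arc (\<gamma> {u, v})" "{pathstart (\<gamma> {u, v}), pathfinish (\<gamma> {u, v})} = {p u, p v}"
proof -
  have "{u, v} \<in> edges G"
    using assms by (auto simp: edges_def)
  then show "arc (\<gamma> {u, v})" "{pathstart (\<gamma> {u, v}), pathfinish (\<gamma> {u, v})} = {p u, p v}"
    using drawing by (auto simp: plane_drawing_def)
qed

text \<open>
  The curve of an edge has no preferred direction; reversing it if necessary makes it start at
  \<open>p u\<close>.
\<close>

lemma edge_arc:
  assumes "adj u v"
  obtains g where "arc g" "pathstart g = p u" "pathfinish g = p v"
    "path_image g = path_image (\<gamma> {u, v})"
proof (cases "pathstart (\<gamma> {u, v}) = p u \<and> pathfinish (\<gamma> {u, v}) = p v")
  case True
  then show ?thesis
    using that edge_drawing[OF assms] by blast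
next
  case False
  then have "pathstart (\<gamma> {u, v}) = p v \<and> pathfinish (\<gamma> {u, v}) = p u"
    using edge_drawing(2)[OF assms] by (auto simp: doubleton_eq_iff)
  then show ?thesis
    using that[of "reversepath (\<gamma> {u, v})"] edge_drawing(1)[OF assms] by (simp add: arc_reversepath)
qed

lemma path_edges_in_edges: "successively adj vs \<Longrightarrow> e \<in> path_edges vs \<Longrightarrow> e \<in> edges G"
proof (induction vs rule: path_edges.induct)
  case (1 x y zs)
  have "{x, y} \<in> edges G"
    using 1(2) unfolding edges_def by auto
  then show ?case
    using 1 by auto
qed auto

lemma drawn_Int:
  assumes "successively adj vs" "successively adj ws" "path_edges vs \<inter> path_edges ws = {}"
  shows "drawn vs \<inter> drawn ws \<subseteq> p ` (set vs \<inter> set ws)"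
proof
  fix z assume "z \<in> drawn vs \<inter> drawn ws"
  then obtain e f where ef: "e \<in> path_edges vs" "f \<in> path_edges ws"
      "z \<in> path_image (\<gamma> e) \<inter> path_image (\<gamma> f)"
    unfolding drawn_def by blast
  have "e \<in> edges G" "f \<in> edges G"
    using assms path_edges_in_edges ef by auto
  moreover have "e \<noteq> f"
    using assms(3) ef by auto
  ultimately have "z \<in> p ` (e \<inter> f)"
    using edges_Int[of e f] ef(3) by simp
  then show "z \<in> p ` (set vs \<inter> set ws)"
    using path_edges_subset[OF ef(1)] path_edges_subset[OF ef(2)] by blast
qed

lemma path_arc:
  assumes "successively adj vs" "distinct vs" "length vs \<ge> 2"
  obtains g where "arc g" "pathstart g = p (hd vs)" "pathfinish g = p (last vs)"
    "path_image g = drawn vs"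
proof -
  have "\<exists>g. arc g \<and> pathstart g = p (hd vs) \<and> pathfinish g = p (last vs) \<and> path_image g = drawn vs"
    using assms
  proof (induction vs rule: path_edges.induct)
    case (1 x y zs)
    obtain h where h: "arc h" "pathstart h = p x" "pathfinish h = p y"
        "path_image h = path_image (\<gamma> {x, y})"
      using 1(2) edge_arc[of x y] by auto
    show ?case
    proof (cases zs)
      case Nil
      then show ?thesis
        using h by (auto simp: drawn_def)
    next
      case (Cons z zs')
      then obtain g where g: "arc g" "pathstart g = p y" "pathfinish g = p (last (y # zs))"
          "path_image g = drawn (y # zs)"
        using 1 by auto
      have "{x, y} \<notin> path_edges (y # zs)"
        using path_edges_subset[of "{x, y}" "y # zs"] 1(3) by auto
      then have "drawn [x, y] \<inter> drawn (y # zs) \<subseteq> p ` ({x, y} \<inter> set (y # zs))"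
        using drawn_Int[of "[x, y]" "y # zs"] 1(2) by simp
      also have "\<dots> \<subseteq> {p y}"
        using 1(3) by auto
      finally have "path_image h \<inter> path_image g \<subseteq> {pathstart g}"
        using h(4) g(2,4) by (simp add: drawn_def)
      then have "arc (h +++ g)"
        using h g by (intro arc_join) simp_all
      moreover have "path_image (h +++ g) = drawn (x # y # zs)"
        using h g by (simp add: path_image_join drawn_def)
      ultimately show ?thesis
        using h g by (intro exI[of _ "h +++ g"]) simp
    qed
  qed auto
  then show ?thesis
    using that by blast
qed

lemma path_between_arc:
  assumes "successively adj (x # q @ [y])" "distinct (x # y # q)"
  obtains g where "arc g" "pathstart g = p x" "pathfinish g = p y" "path_image g = drawn (x # q @ [y])"
proof -
  have "distinct (x # q @ [y])" "length (x # q @ [y]) \<ge> 2"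
    using assms(2) by auto
  then obtain g where "arc g" "pathstart g = p (hd (x # q @ [y]))"
      "pathfinish g = p (last (x # q @ [y]))" "path_image g = drawn (x # q @ [y])"
    by (rule path_arc[OF assms(1)])
  then show ?thesis
    using that[of g] by simp
qed

lemma drawn_append: "drawn (xs @ y # ys) = drawn (xs @ [y]) \<union> drawn (y # ys)"
  unfolding drawn_def by (subst path_edges_append) (rule UN_Un)

lemma drawn_rev: "drawn (rev xs) = drawn xs"
  unfolding drawn_def path_edges_rev ..

lemma vertex_in_drawn:
  assumes "successively adj vs" "length vs \<ge> 2" "v \<in> set vs"
  shows "p v \<in> drawn vs"
proof -
  obtain e where e: "e \<in> path_edges vs" "v \<in> e"
    using path_edges_cover assms by metis
  then have "e \<in> edges G"
    using path_edges_in_edges assms(1) by blast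
  then have "p ` e \<subseteq> path_image (\<gamma> e)"
    by (simp add: pathstart_in_path_image pathfinish_in_path_image flip: edge_ends)
  then show ?thesis
    using e by (auto simp: drawn_def)
qed

lemma drawn_subset_drawing: "successively adj vs \<Longrightarrow> drawn vs \<subseteq> drawing_points G p \<gamma>"
  using path_edges_in_edges by (auto simp: drawn_def drawing_points_def)

lemma closed_drawn:
  assumes "successively adj vs"
  shows "closed (drawn vs)"
proof -
  have "finite (path_edges vs)"
    by (induction vs rule: path_edges.induct) auto
  moreover have "closed (path_image (\<gamma> e))" if "e \<in> path_edges vs" for e
    using path_edges_in_edges[OF assms that] drawing
    by (auto simp: plane_drawing_def intro: closed_arc_image)
  ultimately show ?thesis
    by (auto simp: drawn_def)
qed

text \<open>
  This is the only use of outerplanarity beyond planarity: a vertex is a limit of points outside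
  the drawing, which are also outside \<open>S\<close>, whereas the inside of \<open>S\<close> is open.
\<close>

lemma vertex_not_inside:
  assumes "v \<in> pverts G" "closed S" "S \<subseteq> drawing_points G p \<gamma>"
  shows "p v \<notin> inside S"
proof
  assume "p v \<in> inside S"
  moreover have "p v \<in> closure (outside (drawing_points G p \<gamma>))"
    using outer assms(1) by (auto simp: frontier_def)
  ultimately have "inside S \<inter> outside (drawing_points G p \<gamma>) \<noteq> {}"
    using open_inside[OF assms(2)] open_Int_closure_eq_empty by blast
  then show False
    using outside_mono[OF assms(3)] inside_Int_outside[of S] by blast
qed

text \<open>
  A path from \<open>x\<close> to \<open>y\<close> is given here, and below, by the list \<open>q\<close> of its inner vertices.
\<close>

lemma drawn_paths_meet_in_ends:
  assumes "successively adj (x # q @ [y])" "successively adj (x # r @ [y])"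
    and "distinct (x # y # q @ r)" "q \<noteq> [] \<or> r \<noteq> []"
  shows "drawn (x # q @ [y]) \<inter> drawn (x # r @ [y]) = {p x, p y}"
proof
  have "path_edges (x # q @ [y]) \<inter> path_edges (x # r @ [y]) = {}"
  proof (rule ccontr)
    assume "\<not> ?thesis"
    then obtain e where e: "e \<in> path_edges (x # q @ [y])" "e \<in> path_edges (x # r @ [y])"
      by blast
    then have sub: "e \<subseteq> insert x (insert y (set q))" "e \<subseteq> insert x (insert y (set r))"
      using path_edges_subset[OF e(1)] path_edges_subset[OF e(2)] by auto
    show False
      using assms(4)
    proof
      assume "q \<noteq> []"
      then show False
        using path_edges_meet_interior[OF e(1)] sub(2) assms(3) by auto
    next
      assume "r \<noteq> []"
      then show False
        using path_edges_meet_interior[OF e(2)] sub(1) assms(3) by auto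
    qed
  qed
  then have "drawn (x # q @ [y]) \<inter> drawn (x # r @ [y]) \<subseteq>
      p ` (set (x # q @ [y]) \<inter> set (x # r @ [y]))"
    by (rule drawn_Int[OF assms(1,2)])
  also have "\<dots> \<subseteq> {p x, p y}"
    using assms(3) by auto
  finally show "drawn (x # q @ [y]) \<inter> drawn (x # r @ [y]) \<subseteq> {p x, p y}" .
  show "{p x, p y} \<subseteq> drawn (x # q @ [y]) \<inter> drawn (x # r @ [y])"
    using vertex_in_drawn[OF assms(1)] vertex_in_drawn[OF assms(2)] by auto
qed

lemma path_verts: "successively adj vs \<Longrightarrow> length vs \<ge> 2 \<Longrightarrow> set vs \<subseteq> pverts G"
proof (induction vs rule: path_edges.induct)
  case (1 x y zs)
  then show ?case
    using adj_verts[of x y] by (cases zs) auto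
qed auto

lemma vertex_image_eq: "u \<in> pverts G \<Longrightarrow> v \<in> pverts G \<Longrightarrow> p u = p v \<longleftrightarrow> u = v"
  using drawing unfolding plane_drawing_def inj_on_def by blast

lemma interior_not_inside:
  assumes t: "successively adj (x # t @ [y])" "t \<noteq> []" "distinct (x # y # t)"
    and us: "successively adj us" "successively adj ws"
  shows "\<not> drawn (x # t @ [y]) - {p x, p y} \<subseteq> inside (drawn us \<union> drawn ws)"
proof -
  obtain v where v: "v \<in> set t"
    using t(2) by (cases t) auto
  then have "v \<in> pverts G" "x \<in> pverts G" "y \<in> pverts G"
    using path_verts[OF t(1)] by auto
  moreover have "v \<noteq> x" "v \<noteq> y"
    using v t(3) by auto
  ultimately have "p v \<in> drawn (x # t @ [y]) - {p x, p y}"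
    using vertex_in_drawn[OF t(1), of v] v vertex_image_eq by auto
  moreover have "p v \<notin> inside (drawn us \<union> drawn ws)"
    using \<open>v \<in> pverts G\<close> us
    using closed_drawn drawn_subset_drawing by (intro vertex_not_inside closed_Un) simp_all
  ultimately show ?thesis
    by blast
qed

text \<open>
  Of the three arcs, those with inner vertices cannot be the one inside the other two. So if at
  most the third path is a single edge, it is the third one that runs inside.
\<close>

lemma short_path_inside:
  assumes q: "successively adj (x # q @ [y])" "q \<noteq> []"
    and r: "successively adj (x # r @ [y])" "r \<noteq> []"
    and s: "successively adj (x # s @ [y])"
    and dist: "distinct (x # y # q @ r @ s)"
  shows "drawn (x # s @ [y]) - {p x, p y} \<subseteq> inside (drawn (x # q @ [y]) \<union> drawn (x # r @ [y]))"
proof -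
  obtain c1 where c1: "arc c1" "pathstart c1 = p x" "pathfinish c1 = p y"
      "path_image c1 = drawn (x # q @ [y])"
    using path_between_arc[OF q(1)] dist by auto
  obtain c2 where c2: "arc c2" "pathstart c2 = p x" "pathfinish c2 = p y"
      "path_image c2 = drawn (x # r @ [y])"
    using path_between_arc[OF r(1)] dist by auto
  obtain c3 where c3: "arc c3" "pathstart c3 = p x" "pathfinish c3 = p y"
      "path_image c3 = drawn (x # s @ [y])"
    using path_between_arc[OF s] dist by auto
  have i12: "path_image c1 \<inter> path_image c2 = {p x, p y}"
    unfolding c1(4) c2(4) by (rule drawn_paths_meet_in_ends) (use assms in auto)
  have i13: "path_image c1 \<inter> path_image c3 = {p x, p y}"
    unfolding c1(4) c3(4) by (rule drawn_paths_meet_in_ends) (use assms in auto)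
  have i23: "path_image c2 \<inter> path_image c3 = {p x, p y}"
    unfolding c2(4) c3(4) by (rule drawn_paths_meet_in_ends) (use assms in auto)
  have "\<not> drawn (x # q @ [y]) - {p x, p y} \<subseteq> inside (drawn (x # r @ [y]) \<union> drawn (x # s @ [y]))"
    by (rule interior_not_inside) (use assms in auto)
  moreover have "\<not> drawn (x # r @ [y]) - {p x, p y} \<subseteq> inside (drawn (x # q @ [y]) \<union> drawn (x # s @ [y]))"
    by (rule interior_not_inside) (use assms in auto)
  ultimately show ?thesis
    using theta_arc_inside[OF c1(1-3) c2(1-3) c3(1-3) i12 i13 i23] unfolding c1(4) c2(4) c3(4)
    by blast
qed

lemma no_three_paths:
  assumes "successively adj (x # q @ [y])" "successively adj (x # r @ [y])"
    "successively adj (x # s @ [y])" "distinct (x # y # q @ r @ s)"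
  shows "q = [] \<or> r = [] \<or> s = []"
proof (rule ccontr)
  assume ne: "\<not> ?thesis"
  then have "drawn (x # s @ [y]) - {p x, p y} \<subseteq> inside (drawn (x # q @ [y]) \<union> drawn (x # r @ [y]))"
    using assms by (intro short_path_inside) auto
  then show False
    using interior_not_inside[of x s y "x # q @ [y]" "x # r @ [y]"] assms ne by auto
qed

lemma vertex_in_drawnD:
  assumes "p v \<in> drawn vs" "v \<in> pverts G" "successively adj vs"
  shows "v \<in> set vs"
proof -
  obtain e where e: "e \<in> path_edges vs" "p v \<in> path_image (\<gamma> e)"
    using assms(1) by (auto simp: drawn_def)
  have "e \<in> edges G"
    using path_edges_in_edges[OF assms(3) e(1)] .
  moreover have "p v \<in> path_image (\<gamma> e) \<inter> p ` pverts G"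
    using e(2) assms(2) by simp
  ultimately obtain u where u: "u \<in> e" "p u = p v"
    unfolding edge_vertices[OF \<open>e \<in> edges G\<close>] by (auto simp del: Int_iff)
  have "e \<subseteq> pverts G"
    using \<open>e \<in> edges G\<close> adj_verts by (auto simp: edges_def)
  then have "u = v"
    using u assms(2) vertex_image_eq by blast
  then show ?thesis
    using path_edges_subset[OF e(1)] u(1) by blast
qed

text \<open>
  Each chord forms a theta curve with the cycle, so both chords run inside the cycle. The chord
  \<open>ac\<close> splits this inside into the insides of two curves, one through \<open>b\<close> and one through \<open>d\<close>. The
  chord \<open>bd\<close> misses \<open>ac\<close>, so its interior stays inside one of these two curves, and then one of
  its ends is inside that curve.
\<close>

lemma no_crossing_chords:
  assumes cyc: "successively adj (a # q1 @ b # q2 @ c # q3 @ d # q4 @ [a])"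
    and dist: "distinct (a # q1 @ b # q2 @ c # q3 @ d # q4)"
    and ac: "adj a c" and bd: "adj b d"
  shows False
proof -
  \<comment> \<open>The primed pair describes the same cycle, cut at \<open>b\<close> and \<open>d\<close> instead of \<open>a\<close> and \<open>c\<close>.\<close>
  let ?P = "a # (q1 @ b # q2) @ [c]" and ?R = "a # (rev q4 @ d # rev q3) @ [c]"
  let ?P' = "b # (q2 @ c # q3) @ [d]" and ?R' = "b # (rev q1 @ a # rev q4) @ [d]"
  have paths: "successively adj ?P" "successively adj ?R" "successively adj ?P'" "successively adj ?R'"
  proof -
    show "successively adj ?P" "successively adj ?P'"
      using cyc by (simp_all add: successively_append_iff successively_Cons hd_append split: if_splits)
    have "successively adj (c # q3 @ d # q4 @ [a])" "successively adj (d # q4 @ a # q1 @ [b])"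
      using cyc by (simp_all add: successively_append_iff successively_Cons hd_append split: if_splits)
    from this[THEN successively_adj_rev] show "successively adj ?R" "successively adj ?R'"
      by simp_all
  qed
  have chords: "successively adj (a # [] @ [c])" "successively adj (b # [] @ [d])"
    using ac bd by auto
  have R: "drawn ?R = drawn (c # q3 @ d # q4 @ [a])"
    using drawn_rev[of "c # q3 @ d # q4 @ [a]"] by simp
  have R': "drawn ?R' = drawn (d # q4 @ [a]) \<union> drawn (a # q1 @ [b])"
    using drawn_rev[of "d # q4 @ a # q1 @ [b]"] drawn_append[of "d # q4" a "q1 @ [b]"] by simp
  have same_cycle: "drawn ?P' \<union> drawn ?R' = drawn ?P \<union> drawn ?R"
    using drawn_append[of "a # q1" b "q2 @ [c]"] drawn_append[of "c # q3" d "q4 @ [a]"]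
      drawn_append[of "b # q2" c "q3 @ [d]"] R R' by auto
  let ?ac = "drawn [a, c]" and ?bd = "drawn [b, d]"
  have "drawn (a # [] @ [c]) - {p a, p c} \<subseteq> inside (drawn ?P \<union> drawn ?R)"
    by (rule short_path_inside[OF paths(1) _ paths(2) _ chords(1)]) (use dist in auto)
  then have ac_inside: "?ac - {p a, p c} \<subseteq> inside (drawn ?P \<union> drawn ?R)"
    by simp
  have "drawn (b # [] @ [d]) - {p b, p d} \<subseteq> inside (drawn ?P' \<union> drawn ?R')"
    by (rule short_path_inside[OF paths(3) _ paths(4) _ chords(2)]) (use dist in auto)
  then have bd_inside: "?bd - {p b, p d} \<subseteq> inside (drawn ?P \<union> drawn ?R)"
    unfolding same_cycle by simp
  have verts: "a \<in> pverts G" "b \<in> pverts G" "c \<in> pverts G" "d \<in> pverts G"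
    using adj_verts ac bd by blast+
  have ne: "p a \<noteq> p c" "p b \<noteq> p d" "p b \<noteq> p a" "p b \<noteq> p c"
    using vertex_image_eq verts dist by auto
  obtain c1 where c1: "arc c1" "pathstart c1 = p a" "pathfinish c1 = p c"
      "path_image c1 = drawn ?P"
    using path_between_arc[OF paths(1)] dist by (auto simp: Int_Un_distrib)
  obtain c2 where c2: "arc c2" "pathstart c2 = p a" "pathfinish c2 = p c"
      "path_image c2 = drawn ?R"
    using path_between_arc[OF paths(2)] dist by (auto simp: Int_Un_distrib)
  obtain c0 where c0: "arc c0" "pathstart c0 = p a" "pathfinish c0 = p c"
      "path_image c0 = ?ac"
    using path_between_arc[OF chords(1)] dist by (auto simp: Int_Un_distrib)
  obtain g where g: "arc g" "pathstart g = p b" "pathfinish g = p d" "path_image g = ?bd"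
    using path_between_arc[OF chords(2)] dist by (auto simp: Int_Un_distrib)
  have i12: "path_image c1 \<inter> path_image c2 = {p a, p c}"
    unfolding c1(4) c2(4) using paths dist by (intro drawn_paths_meet_in_ends) auto
  have i10: "path_image c1 \<inter> path_image c0 = {p a, p c}"
    unfolding c1(4) c0(4) using drawn_paths_meet_in_ends[OF paths(1) chords(1)] dist by auto
  have i20: "path_image c2 \<inter> path_image c0 = {p a, p c}"
    unfolding c2(4) c0(4) using drawn_paths_meet_in_ends[OF paths(2) chords(1)] dist by auto
  have "path_image c0 \<inter> inside (path_image c1 \<union> path_image c2) \<noteq> {}"
  proof -
    have "connected (path_image c0)" "p a \<in> path_image c0" "p c \<in> path_image c0"
      using c0(1) i10 by (auto simp: arc_def connected_path_image)
    then have "path_image c0 - {p a, p c} \<noteq> {}"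
      using connected_diff_ends_closure ne(1) closure_empty by (metis empty_iff)
    then show ?thesis
      using ac_inside c0(4) c1(4) c2(4) by auto
  qed
  then have split: "inside (drawn ?P \<union> drawn ?R) \<subseteq>
      inside (drawn ?P \<union> ?ac) \<union> inside (drawn ?R \<union> ?ac) \<union> ?ac"
    using split_inside_simple_closed_curve[OF arc_imp_simple_path[OF c1(1)] c1(2,3)
        arc_imp_simple_path[OF c2(1)] c2(2,3) arc_imp_simple_path[OF c0(1)] c0(2,3) ne(1) i12 i10 i20]
    unfolding c1(4) c2(4) c0(4) by blast
  have "?bd \<inter> ?ac \<subseteq> p ` ({b, d} \<inter> {a, c})"
  proof -
    have "path_edges [b, d] \<inter> path_edges [a, c] = {}"
      using dist by (auto simp: doubleton_eq_iff)
    then show ?thesis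
      using drawn_Int[of "[b, d]" "[a, c]"] chords by simp
  qed
  then have disj: "?bd \<inter> ?ac = {}"
    using dist by auto
  have conn: "connected (?bd - {p b, p d})"
    using connected_simple_path_endless[OF arc_imp_simple_path[OF g(1)]] g by simp
  have ends: "p d \<in> closure (?bd - {p b, p d})" "p b \<in> closure (?bd - {p b, p d})"
  proof -
    have "connected ?bd" "p b \<in> ?bd" "p d \<in> ?bd"
      using connected_arc_image[OF g(1)] pathstart_in_path_image[of g] pathfinish_in_path_image[of g]
      unfolding g(2,3,4) .
    then show "p d \<in> closure (?bd - {p b, p d})" "p b \<in> closure (?bd - {p b, p d})"
      using connected_diff_ends_closure[of ?bd "p b" "p d"] connected_diff_ends_closure[of ?bd "p d" "p b"]
        ne(2) by (simp_all add: insert_commute)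
  qed
  \<comment> \<open>An end of \<open>bd\<close> is a limit of the interior of \<open>bd\<close>; as a vertex it is not inside, so it lies on the curve itself.\<close>
  have no_end_inside: "v \<in> set vs"
    if sub: "?bd - {p b, p d} \<subseteq> inside (drawn vs \<union> ?ac)" and vs: "successively adj vs"
      and v: "v \<in> {b, d}" for v vs
  proof -
    have clo: "closed (drawn vs \<union> ?ac)"
      using closed_drawn[OF vs] closed_drawn[of "[a, c]"] chords by (intro closed_Un) simp_all
    have vG: "v \<in> pverts G"
      using v verts by auto
    have "p v \<in> closure (inside (drawn vs \<union> ?ac))"
      using ends closure_mono[OF sub] v by blast
    then have "p v \<in> drawn vs \<union> ?ac \<union> inside (drawn vs \<union> ?ac)"
      using closure_inside_subset[OF clo] by blast
    moreover have "drawn vs \<union> ?ac \<subseteq> drawing_points G p \<gamma>"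
      using drawn_subset_drawing[OF vs] drawn_subset_drawing[OF chords(1)] by simp
    then have "p v \<notin> inside (drawn vs \<union> ?ac)"
      by (rule vertex_not_inside[OF vG clo])
    moreover have "p v \<notin> ?ac"
      using vertex_in_drawnD[OF _ vG, of "[a, c]"] chords v dist by auto
    ultimately show ?thesis
      using vertex_in_drawnD[OF _ vG vs] by blast
  qed
  have "(?bd - {p b, p d}) \<inter> (drawn ?P \<union> ?ac) = {}"
    using bd_inside inside_no_overlap[of "drawn ?P \<union> drawn ?R"] disj by blast
  then consider "?bd - {p b, p d} \<subseteq> inside (drawn ?P \<union> ?ac)"
    | "?bd - {p b, p d} \<subseteq> outside (drawn ?P \<union> ?ac)"
    using connected_subset_inside_or_outside[OF conn] by blast
  then show False
  proof cases
    case 1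
    then show False
      using no_end_inside[OF 1 paths(1), of d] dist by auto
  next
    case 2
    then have "?bd - {p b, p d} \<subseteq> inside (drawn ?R \<union> ?ac)"
      using bd_inside split disj inside_Int_outside[of "drawn ?P \<union> ?ac"] by blast
    then show False
      using no_end_inside[OF _ paths(2), of b] dist by auto
  qed
qed

end


section \<open>Noncrossing orders from excluded paths and chords\<close>

text \<open>
  The linear order is given by an injective ranking \<open>f\<close> of the vertices, whose values may have
  gaps. The condition is invariant under cyclic rotation of the order when \<open>E\<close> is symmetric.
\<close>

definition noncrossing :: "'a set \<Rightarrow> ('a \<Rightarrow> 'a \<Rightarrow> bool) \<Rightarrow> ('a \<Rightarrow> nat) \<Rightarrow> bool" where
  "noncrossing W E f \<longleftrightarrow> inj_on f W \<and>
     (\<forall>a\<in>W. \<forall>b\<in>W. \<forall>c\<in>W. \<forall>d\<in>W. f a < f b \<longrightarrow> f b < f c \<longrightarrow> f c < f d \<longrightarrow> \<not> (E a c \<and> E b d))"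

lemma noncrossingD:
  assumes "noncrossing W E f" "a \<in> W" "b \<in> W" "c \<in> W" "d \<in> W" "f a < f b" "f b < f c" "f c < f d"
  shows "\<not> (E a c \<and> E b d)"
  using assms unfolding noncrossing_def by blast

text \<open>A crossing involves four vertices, so every order will do.\<close>

lemma noncrossing_small:
  assumes "finite W" "card W \<le> 3"
  shows "\<exists>f. noncrossing W E f"
proof -
  obtain f :: "'a \<Rightarrow> nat" where f: "inj_on f W"
    using finite_imp_inj_to_nat_seg[OF assms(1)] by blast
  have False if "a \<in> W" "b \<in> W" "c \<in> W" "d \<in> W" "f a < f b" "f b < f c" "f c < f d" for a b c d
  proof -
    have "card {a, b, c, d} = 4"
      using that by (auto simp: card_insert_if)
    moreover have "card {a, b, c, d} \<le> card W"
      using that by (intro card_mono assms(1)) auto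
    ultimately show False
      using assms(2) by simp
  qed
  then have "noncrossing W E f"
    using f unfolding noncrossing_def by blast
  then show ?thesis
    by blast
qed

lemma noncrossing_rotate:
  assumes f: "noncrossing W E f" and "finite W" "v \<in> W" and sym: "\<And>a b. E a b \<Longrightarrow> E b a"
  shows "\<exists>g. noncrossing W E g \<and> g v = 0 \<and> (\<forall>u \<in> W - {v}. 0 < g u)"
proof -
  obtain M where M: "\<And>u. u \<in> W \<Longrightarrow> f u < M"
    using finite_nat_set_iff_bounded[of "f ` W"] assms(2) by auto
  define g where "g u = (if f v \<le> f u then f u - f v else f u + M)" for u
  have inj: "inj_on f W"
    using f by (simp add: noncrossing_def)
  have less: "g a < g b \<longleftrightarrow> (f v \<le> f a \<and> f a < f b) \<or> (f a < f b \<and> f b < f v) \<or> (f v \<le> f a \<and> f b < f v)"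
    if "a \<in> W" "b \<in> W" for a b
    using M[OF that(1)] M[OF that(2)] M[OF \<open>v \<in> W\<close>] by (auto simp: g_def)
  have "inj_on g W"
  proof (rule inj_onI)
    fix a b assume "a \<in> W" "b \<in> W" "g a = g b"
    then have "f a = f b"
      using M[of a] M[of b] by (auto simp: g_def split: if_splits)
    then show "a = b"
      using inj \<open>a \<in> W\<close> \<open>b \<in> W\<close> by (simp add: inj_on_eq_iff)
  qed
  moreover have "\<not> (E a c \<and> E b d)"
    if W: "a \<in> W" "b \<in> W" "c \<in> W" "d \<in> W" and l: "g a < g b" "g b < g c" "g c < g d" for a b c d
  proof
    assume E: "E a c \<and> E b d"
    consider "f a < f b" "f b < f c" "f c < f d" | "f d < f a" "f a < f b" "f b < f c"
      | "f c < f d" "f d < f a" "f a < f b" | "f b < f c" "f c < f d" "f d < f a"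
      using l unfolding less[OF W(1,2)] less[OF W(2,3)] less[OF W(3,4)] by linarith
    then show False
      using noncrossingD[OF f W] noncrossingD[OF f W(4,1,2,3)] noncrossingD[OF f W(3,4,1,2)]
        noncrossingD[OF f W(2,3,4,1)] E sym by cases blast+
  qed
  ultimately have "noncrossing W E g"
    unfolding noncrossing_def by blast
  moreover have "g v = 0"
    by (simp add: g_def)
  moreover have "0 < g u" if "u \<in> W" "u \<noteq> v" for u
    using less[of v u] that \<open>v \<in> W\<close> inj \<open>g v = 0\<close> \<open>inj_on g W\<close> by (metis gr0I inj_on_eq_iff)
  ultimately show ?thesis
    by blast
qed

text \<open>
  Both orders start at the common vertex \<open>v\<close>; the new order lists \<open>v\<close>, then \<open>A\<close>, then \<open>B\<close>. An edge
  within \<open>A\<close> ends before an edge within \<open>B\<close> begins. An edge at the first vertex \<open>v\<close> crosses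
  nothing on the other side either: what lies under an edge from \<open>v\<close> to \<open>B\<close> but in \<open>A\<close> has no
  edges to vertices beyond it.
\<close>

lemma noncrossing_glue:
  assumes f: "noncrossing (insert v A) E f" "f v = 0" "\<And>u. u \<in> A \<Longrightarrow> 0 < f u"
    and g: "noncrossing (insert v B) E g" "g v = 0" "\<And>u. u \<in> B \<Longrightarrow> 0 < g u"
    and sep: "A \<inter> B = {}" "\<And>a b. a \<in> A \<Longrightarrow> b \<in> B \<Longrightarrow> \<not> E a b \<and> \<not> E b a"
    and fin: "finite A"
  shows "\<exists>h. noncrossing (insert v (A \<union> B)) E h"
proof -
  obtain M where M: "\<And>u. u \<in> A \<Longrightarrow> f u < M"
    using finite_nat_set_iff_bounded[of "f ` A"] fin by auto
  have v: "v \<notin> A" "v \<notin> B"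
    using f(2,3) g(2,3) by force+
  define h where "h u = (if u \<in> B then g u + M else f u)" for u
  have hA: "h u = f u" if "u \<in> A" for u
    using that sep(1) by (auto simp: h_def)
  have hB: "h u = g u + M" if "u \<in> B" for u
    using that by (simp add: h_def)
  have hv: "h v = 0"
    using v f(2) by (simp add: h_def)
  have AB: "h a < h b" if "a \<in> A" "b \<in> B" for a b
    using M[OF that(1)] hA[OF that(1)] hB[OF that(2)] by simp
  have hB': "h a < h b \<longleftrightarrow> g a < g b" if "a \<in> insert v B" "b \<in> insert v B" for a b
    using that hB hv g(2,3) by auto
  have hA': "h a < h b \<longleftrightarrow> f a < f b" if "a \<in> insert v A" "b \<in> insert v A" for a b
    using that hA hv f(2,3) by auto
  have inj: "inj_on f (insert v A)" "inj_on g (insert v B)"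
    using f(1) g(1) by (simp_all add: noncrossing_def)
  have "inj_on h (insert v (A \<union> B))"
  proof (rule inj_onI)
    fix a b assume ab: "a \<in> insert v (A \<union> B)" "b \<in> insert v (A \<union> B)" "h a = h b"
    then consider "a \<in> insert v A" "b \<in> insert v A" | "a \<in> insert v B" "b \<in> insert v B"
      using AB by force
    then show "a = b"
    proof cases
      case 1
      then have "f a = f b"
        using ab(3) hA'[of a b] hA'[of b a] by auto
      then show ?thesis
        using inj(1) 1 by (simp only: inj_on_eq_iff)
    next
      case 2
      then have "g a = g b"
        using ab(3) hB'[of a b] hB'[of b a] by auto
      then show ?thesis
        using inj(2) 2 by (simp only: inj_on_eq_iff)
    qed
  qed
  moreover have "\<not> (E a c \<and> E b d)"
    if W: "a \<in> insert v (A \<union> B)" "b \<in> insert v (A \<union> B)" "c \<in> insert v (A \<union> B)" "d \<in> insert v (A \<union> B)"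
      and l: "h a < h b" "h b < h c" "h c < h d" for a b c d
  proof
    assume E: "E a c \<and> E b d"
    have not_v: "b \<noteq> v" "c \<noteq> v" "d \<noteq> v"
      using l hv by auto
    have "a \<in> insert v A \<and> c \<in> insert v A \<or> a \<in> insert v B \<and> c \<in> insert v B"
      using W(1,3) E sep(2) by blast
    moreover have "b \<in> A \<and> d \<in> A \<or> b \<in> B \<and> d \<in> B"
      using W(2,4) not_v E sep(2) by blast
    ultimately consider "a \<in> insert v A" "c \<in> A" "b \<in> A" "d \<in> A"
      | "a \<in> insert v B" "c \<in> B" "b \<in> B" "d \<in> B"
      | "c \<in> A" "b \<in> B" | "c \<in> B" "d \<in> A"
      using not_v by blast
    then show False
    proof cases
      case 1
      then show False
        using noncrossingD[OF f(1), of a b c d] hA' l E by blast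
    next
      case 2
      then show False
        using noncrossingD[OF g(1), of a b c d] hB' l E by blast
    next
      case 3
      then show False
        using AB[of c b] l by simp
    next
      case 4
      then show False
        using AB[of d c] l by simp
    qed
  qed
  ultimately have "noncrossing (insert v (A \<union> B)) E h"
    unfolding noncrossing_def by blast
  then show ?thesis
    by blast
qed

lemma simple_path_in_rtrancl:
  assumes "(a, b) \<in> R\<^sup>*"
  shows "\<exists>p. p \<noteq> [] \<and> distinct p \<and> hd p = a \<and> last p = b \<and> successively (\<lambda>x y. (x, y) \<in> R) p \<and>
    set p \<subseteq> R\<^sup>* `` {a}"
  using assms
proof (induction rule: rtrancl_induct)
  case base
  show ?case
    by (intro exI[of _ "[a]"]) auto
next
  case (step b c)
  then obtain p where p: "p \<noteq> []" "distinct p" "hd p = a" "last p = b"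
      "successively (\<lambda>x y. (x, y) \<in> R) p" "set p \<subseteq> R\<^sup>* `` {a}"
    by blast
  show ?case
  proof (cases "c \<in> set p")
    case True
    then obtain q r where "p = q @ c # r"
      by (meson split_list)
    then have pq: "p = (q @ [c]) @ r"
      by simp
    have "successively (\<lambda>x y. (x, y) \<in> R) (q @ [c])"
      using p(5) unfolding pq by (simp only: successively_append_iff[of _ "q @ [c]"])
    moreover have "hd (q @ [c]) = a"
      using p(3) unfolding pq by (cases q) auto
    ultimately show ?thesis
      using p(2,6) unfolding pq by (intro exI[of _ "q @ [c]"]) auto
  next
    case False
    have "c \<in> R\<^sup>* `` {a}"
      using step by auto
    then show ?thesis
      using p step(2) False by (intro exI[of _ "p @ [c]"]) (auto simp: successively_append_iff)
  qed
qed

lemma successively_join: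
  "successively P (xs @ [y]) \<Longrightarrow> successively P (y # ys) \<Longrightarrow> successively P (xs @ y # ys)"
  by (simp add: successively_append_iff)

lemma drop_split:
  assumes "i < j" "j \<le> length xs"
  shows "\<exists>ys. drop i xs = xs ! i # ys @ drop j xs"
proof -
  have "drop i xs = xs ! i # drop (Suc i) xs"
    using assms by (simp add: Cons_nth_drop_Suc)
  moreover have "drop (Suc i) xs = take (j - Suc i) (drop (Suc i) xs) @ drop (j - Suc i) (drop (Suc i) xs)"
    by (rule append_take_drop_id[symmetric])
  moreover have "drop (j - Suc i) (drop (Suc i) xs) = drop j xs"
    using assms by simp
  ultimately show ?thesis
    by metis
qed

text \<open>
  Length two is allowed: a single edge, traversed back and forth, counts as a cycle. It serves as
  the starting point when a longest cycle is chosen.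
\<close>

definition cycle_in :: "('a \<Rightarrow> 'a \<Rightarrow> bool) \<Rightarrow> 'a set \<Rightarrow> 'a list \<Rightarrow> bool" where
  "cycle_in E W xs \<longleftrightarrow> 2 \<le> length xs \<and> distinct xs \<and> set xs \<subseteq> W \<and> successively E (xs @ [hd xs])"

lemma cycle_in_rotate:
  assumes "cycle_in E W (xs @ ys)"
  shows "cycle_in E W (ys @ xs)"
proof (cases "xs = [] \<or> ys = []")
  case True
  then show ?thesis
    using assms by auto
next
  case False
  then show ?thesis
    using assms by (auto simp: cycle_in_def successively_append_iff)
qed


text \<open>The drawing enters the combinatorial part only through these two exclusions.\<close>

locale theta_chord_free =
  fixes E :: "'a \<Rightarrow> 'a \<Rightarrow> bool"
  assumes sym: "E a b \<Longrightarrow> E b a"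
    and theta_free: "\<lbrakk>successively E (x # q @ [y]); successively E (x # r @ [y]);
      successively E (x # s @ [y]); distinct (x # y # q @ r @ s)\<rbrakk> \<Longrightarrow> q = [] \<or> r = [] \<or> s = []"
    and chord_free: "\<lbrakk>successively E (a # q1 @ b # q2 @ c # q3 @ d # q4 @ [a]);
      distinct (a # q1 @ b # q2 @ c # q3 @ d # q4); E a c; E b d\<rbrakk> \<Longrightarrow> False"
begin

lemma successively_rev_sym: "successively E xs \<Longrightarrow> successively E (rev xs)"
  unfolding successively_rev by (erule successively_mono) (rule sym)

lemma Hamiltonian_noncrossing:
  assumes "cycle_in E W xs" "set xs = W"
  shows "\<exists>f. noncrossing W E f"
proof -
  define f where "f = the_inv_into {..<length xs} ((!) xs)"
  have dist: "distinct xs"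
    using assms(1) by (simp add: cycle_in_def)
  have bij: "bij_betw ((!) xs) {..<length xs} W"
    using bij_betw_nth[OF dist] assms(2) by simp
  then have inj: "inj_on f W"
    unfolding f_def using bij_betw_the_inv_into bij_betw_imp_inj_on by blast
  have f: "f a < length xs" "xs ! f a = a" if "a \<in> W" for a
    using bij that bij_betw_apply[OF bij_betw_the_inv_into[OF bij] that]
      f_the_inv_into_f_bij_betw[OF bij, of a] unfolding f_def by auto
  have "\<not> (E a c \<and> E b d)"
    if W: "a \<in> W" "b \<in> W" "c \<in> W" "d \<in> W" and l: "f a < f b" "f b < f c" "f c < f d" for a b c d
  proof
    assume E: "E a c \<and> E b d"
    obtain q1 where 1: "drop (f a) xs = a # q1 @ drop (f b) xs"
      using drop_split[OF l(1), of xs] f[OF W(1)] f[OF W(2)] by auto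
    obtain q2 where 2: "drop (f b) xs = b # q2 @ drop (f c) xs"
      using drop_split[OF l(2), of xs] f[OF W(2)] f[OF W(3)] by auto
    obtain q3 where 3: "drop (f c) xs = c # q3 @ drop (f d) xs"
      using drop_split[OF l(3), of xs] f[OF W(3)] f[OF W(4)] by auto
    obtain q4 where 4: "drop (f d) xs = d # q4"
      using Cons_nth_drop_Suc[OF f(1)[OF W(4)]] f(2)[OF W(4)] by metis
    define ps where "ps = take (f a) xs"
    have "xs = ps @ (a # q1 @ b # q2 @ c # q3 @ d # q4)"
      using append_take_drop_id[of "f a" xs] 1 2 3 4 by (simp add: ps_def)
    then have "cycle_in E W ((a # q1 @ b # q2 @ c # q3 @ d # q4) @ ps)"
      using assms(1) cycle_in_rotate by blast
    then show False
      using chord_free[of a q1 b q2 c q3 d "q4 @ ps"] E by (simp add: cycle_in_def)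
  qed
  then show ?thesis
    using inj unfolding noncrossing_def by blast
qed

text \<open>
  A component \<open>K\<close> of the vertices off the cycle is attached to the cycle at two vertices \<open>x\<close> and
  \<open>y\<close>, since no single vertex separates it. A path through \<open>K\<close> from \<open>x\<close> to \<open>y\<close> could replace a
  side of the cycle without inner vertices, giving a longer cycle. So both sides have inner
  vertices, and the path and the two sides are three paths of the excluded kind.
\<close>

lemma maximal_cycle_Hamiltonian:
  assumes "finite W"
    and nonsep: "\<And>v A. v \<in> W \<Longrightarrow> A \<noteq> {} \<Longrightarrow> A \<subset> W - {v} \<Longrightarrow> \<exists>a \<in> A. \<exists>b \<in> W - {v} - A. E a b"
    and cyc: "cycle_in E W xs"
    and max: "\<And>ys. cycle_in E W ys \<Longrightarrow> length ys \<le> length xs"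
  shows "set xs = W"
proof (rule ccontr)
  assume "set xs \<noteq> W"
  moreover have sub: "set xs \<subseteq> W" and len: "2 \<le> length xs" and dist: "distinct xs"
    using cyc by (simp_all add: cycle_in_def)
  ultimately obtain u where u: "u \<in> W - set xs"
    by blast
  define R where "R = {(a, b). a \<in> W - set xs \<and> b \<in> W - set xs \<and> E a b}"
  define K where "K = R\<^sup>* `` {u}"
  have K_sub: "K \<subseteq> W - set xs"
  proof
    fix k assume "k \<in> K"
    then have "(u, k) \<in> R\<^sup>*"
      by (simp add: K_def)
    then show "k \<in> W - set xs"
      by (induction rule: rtrancl_induct) (use u in \<open>auto simp: R_def\<close>)
  qed
  have uK: "u \<in> K"
    by (simp add: K_def)
  have K_closed: "b \<in> K" if "a \<in> K" "E a b" "b \<in> W - set xs" for a b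
  proof -
    have "(a, b) \<in> R"
      using that K_sub by (auto simp: R_def)
    then show ?thesis
      using that(1) by (auto simp: K_def intro: rtrancl_into_rtrancl)
  qed
  have attach: "\<exists>y \<in> set xs. \<exists>k \<in> K. y \<noteq> x \<and> E k y" if x: "x \<in> set xs" for x
  proof -
    have "card (set xs) \<ge> 2"
      using len dist by (simp add: distinct_card)
    then have "\<not> set xs \<subseteq> {x}"
      using card_mono[of "{x}" "set xs"] by auto
    then obtain z where z: "z \<in> set xs" "z \<noteq> x"
      by blast
    then have "z \<in> W - {x}" "z \<notin> K" "K \<subseteq> W - {x}"
      using sub K_sub x by blast+
    then have "K \<subset> W - {x}"
      by blast
    moreover have "x \<in> W" "K \<noteq> {}"
      using x sub uK by blast+
    ultimately obtain a b where "a \<in> K" "b \<in> W - {x} - K" "E a b"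
      using nonsep[of x K] by blast
    then show ?thesis
      using K_closed[of a b] by blast
  qed
  have "hd xs \<in> set xs"
    using len by (cases xs) auto
  then obtain x kx where x: "x \<in> set xs" "kx \<in> K" "E kx x"
    using attach by blast
  then obtain y ky where y: "y \<in> set xs" "ky \<in> K" "y \<noteq> x" "E ky y"
    using attach by blast
  have "sym_on UNIV R"
    using sym by (auto simp: R_def sym_def)
  then have "sym_on UNIV (R\<^sup>*)"
    by (rule sym_rtrancl)
  then have "(kx, ky) \<in> R\<^sup>*"
    using x(2) y(2) unfolding K_def by (auto dest: symD intro: rtrancl_trans)
  then obtain p where p: "p \<noteq> []" "distinct p" "hd p = kx" "last p = ky"
      "successively (\<lambda>x y. (x, y) \<in> R) p" "set p \<subseteq> R\<^sup>* `` {kx}"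
    using simple_path_in_rtrancl[of kx ky R] by blast
  have "set p \<subseteq> K"
    using p(6) x(2) by (auto simp: K_def intro: rtrancl_trans)
  then have p_sub: "set p \<subseteq> W" "set p \<inter> set xs = {}"
    using K_sub by blast+
  have p_path: "successively E p"
    using p(5) by (rule successively_mono) (simp add: R_def)
  have xpy: "successively E (x # p @ [y])"
    using p p_path x(3) y(4) sym by (simp add: successively_Cons successively_append_iff)
  obtain zs1 zs2 where zs: "xs = zs1 @ x # zs2"
    using x(1) by (meson split_list)
  then have "y \<in> set (zs2 @ zs1)"
    using y by auto
  then obtain q r where qr: "zs2 @ zs1 = q @ y # r"
    by (meson split_list)
  have cyc': "cycle_in E W ((x # zs2) @ zs1)"
    using cyc zs cycle_in_rotate by blast
  have len': "length ((x # zs2) @ zs1) = length xs" and set': "set ((x # zs2) @ zs1) = set xs"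
    using zs by auto
  have eq: "(x # zs2) @ zs1 = x # q @ y # r"
    using qr by simp
  have cyc'': "cycle_in E W (x # q @ y # r)" and len'': "length (x # q @ y # r) = length xs"
    and set'': "set (x # q @ y # r) = set xs"
    using cyc' len' set' unfolding eq by simp_all
  have dist'': "distinct (x # q @ y # r)" and sub'': "set (x # q @ y # r) \<subseteq> W"
    using cyc'' unfolding cycle_in_def by blast+
  have "successively E ((x # q @ [y]) @ r @ [x])"
    using cyc'' unfolding cycle_in_def by simp
  then have xqy: "successively E (x # q @ [y])"
    by (simp only: successively_append_iff)
  have "successively E ((x # q) @ (y # r @ [x]))"
    using cyc'' unfolding cycle_in_def by simp
  then have yrx: "successively E (y # r @ [x])"
    by (simp only: successively_append_iff)
  have p_disj: "x \<notin> set p" "y \<notin> set p" "set p \<inter> set q = {}" "set p \<inter> set r = {}"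
    using p_sub(2) set'' by auto
  have "q \<noteq> []"
  proof
    assume "q = []"
    have "successively E ((x # p) @ y # r @ [x])"
      using successively_join[of E "x # p" y "r @ [x]"] xpy yrx by simp
    then have "cycle_in E W (x # p @ y # r)"
      unfolding cycle_in_def using p(2) p_sub p_disj dist'' sub'' by auto
    from max[OF this] len'' show False
      using \<open>q = []\<close> p(1) by (cases p) auto
  qed
  moreover have "r \<noteq> []"
  proof
    assume "r = []"
    have "successively E (y # rev p @ [x])"
      using successively_rev_sym[OF xpy] by simp
    then have "successively E ((x # q) @ y # rev p @ [x])"
      using successively_join[of E "x # q" y "rev p @ [x]"] xqy by simp
    then have "cycle_in E W (x # q @ y # rev p)"
      unfolding cycle_in_def using p(2) p_sub p_disj dist'' sub'' by auto
    from max[OF this] len'' show False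
      using \<open>r = []\<close> p(1) by (cases p) auto
  qed
  moreover have "successively E (x # rev r @ [y])"
    using successively_rev_sym[OF yrx] by simp
  moreover have "distinct (x # y # q @ rev r @ p)"
    using dist'' p(2) p_disj by auto
  ultimately show False
    using theta_free[OF xqy _ xpy, of "rev r"] p(1) by auto
qed

text \<open>
  Induction over induced subgraphs: split at a separating vertex, or else use a Hamiltonian cycle.
\<close>

lemma noncrossing_order_exists:
  assumes "finite W"
  shows "\<exists>f. noncrossing W E f"
  using assms
proof (induction W rule: finite_psubset_induct)
  case (psubset W)
  show ?case
  proof (cases "card W \<le> 3")
    case True
    then show ?thesis
      using noncrossing_small psubset.hyps by blast
  next
    case large: False
    show ?thesis
    proof (cases "\<exists>v \<in> W. \<exists>A. A \<noteq> {} \<and> A \<subset> W - {v} \<and> (\<forall>a \<in> A. \<forall>b \<in> W - {v} - A. \<not> E a b)")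
      case True
      then obtain v A where v: "v \<in> W" "A \<noteq> {}" "A \<subset> W - {v}"
          and sep: "\<forall>a \<in> A. \<forall>b \<in> W - {v} - A. \<not> E a b"
        by auto
      define B where "B = W - {v} - A"
      have fin: "finite A" "finite (insert v A)" "finite (insert v B)"
        using finite_subset[OF _ psubset.hyps, of A] psubset.hyps v(3) unfolding B_def by auto
      have AB: "insert v A \<subset> W" "insert v B \<subset> W" "insert v (A \<union> B) = W"
        using v unfolding B_def by blast+
      obtain f0 where f0: "noncrossing (insert v A) E f0"
        using psubset.IH[OF AB(1)] by (rule exE)
      obtain g0 where g0: "noncrossing (insert v B) E g0"
        using psubset.IH[OF AB(2)] by (rule exE)
      obtain f where f: "noncrossing (insert v A) E f" "f v = 0" "\<forall>u \<in> insert v A - {v}. 0 < f u"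
        using noncrossing_rotate[OF f0 fin(2) insertI1 sym] by blast
      obtain g where g: "noncrossing (insert v B) E g" "g v = 0" "\<forall>u \<in> insert v B - {v}. 0 < g u"
        using noncrossing_rotate[OF g0 fin(3) insertI1 sym] by blast
      have "\<exists>h. noncrossing (insert v (A \<union> B)) E h"
      proof (rule noncrossing_glue[OF f(1,2) _ g(1,2)])
        show "0 < f u" if "u \<in> A" for u
          using f(3) that v(3) by blast
        show "0 < g u" if "u \<in> B" for u
          using g(3) that unfolding B_def by blast
        show "A \<inter> B = {}"
          unfolding B_def by blast
        show "\<not> E a b \<and> \<not> E b a" if "a \<in> A" "b \<in> B" for a b
          using sep that sym[of b a] unfolding B_def by blast
      qed (rule fin(1))
      then show ?thesis
        using AB(3) by simp
    next
      case False
      then have nonsep: "\<exists>a \<in> A. \<exists>b \<in> W - {v} - A. E a b"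
        if "v \<in> W" "A \<noteq> {}" "A \<subset> W - {v}" for v A
        using that by blast
      have "W \<noteq> {}"
        using large by auto
      then obtain v where v: "v \<in> W"
        by blast
      have "2 \<le> card (W - {v})"
        using large v psubset.hyps by simp
      \<comment> \<open>Any edge gives an initial cycle; one exists because \<open>{w}\<close> is not separated from the rest by \<open>v\<close>.\<close>
      then obtain w where w: "w \<in> W - {v}" "{w} \<noteq> W - {v}"
        by (metis One_nat_def card_1_singleton_iff card.empty equals0I not_numeral_le_zero
            numeral_le_one_iff semiring_norm(69))
      then have "{w} \<noteq> {}" "{w} \<subset> W - {v}"
        by auto
      then obtain b where b: "b \<in> W" "b \<noteq> w" "E w b"
        using nonsep[OF v, of "{w}"] by blast
      then have "cycle_in E W [w, b]"
        using w sym by (simp add: cycle_in_def)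
      moreover have "length ys \<le> card W" if "cycle_in E W ys" for ys
        using that card_mono[OF psubset.hyps, of "set ys"] by (simp add: cycle_in_def distinct_card)
      ultimately obtain xs where xs: "cycle_in E W xs" "\<forall>ys. cycle_in E W ys \<longrightarrow> length ys \<le> length xs"
        using ex_has_greatest_nat[of "cycle_in E W" "[w, b]" length "Suc (card W)"] by (auto simp: less_Suc_eq_le)
      then have "set xs = W"
        by (intro maximal_cycle_Hamiltonian[OF psubset.hyps nonsep]) auto
      then show ?thesis
        using Hamiltonian_noncrossing xs(1) by blast
    qed
  qed
qed

end


section \<open>A layered path decomposition from a noncrossing order\<close>

locale noncrossing_graph_order =
  fixes A :: "nat \<Rightarrow> nat \<Rightarrow> bool" and n :: nat
  assumes sym: "A i j \<Longrightarrow> A j i"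
    and noncross: "\<lbrakk>i < j; j < k; k < l; l < n; A i k\<rbrakk> \<Longrightarrow> \<not> A j l"
    and nonempty: "0 < n"
begin

text \<open>
  The points at which the interval \<open>[x, y]\<close> is subdivided. Including \<open>x + 1\<close> and \<open>y - 1\<close> ensures
  that the parts reach every vertex strictly between \<open>x\<close> and \<open>y\<close>.
\<close>

definition stops :: "nat \<Rightarrow> nat \<Rightarrow> nat set" where
  "stops x y = {z. x < z \<and> z < y \<and> (z = Suc x \<or> Suc z = y \<or> A x z \<or> A z y)}"

text \<open>
  The parts are the intervals between consecutive stops. If \<open>x + 1\<close> is the only vertex strictly
  between \<open>x\<close> and \<open>y\<close>, there are no two stops, and the one-point interval takes their place.
\<close>

definition child :: "nat \<Rightarrow> nat \<Rightarrow> nat \<Rightarrow> nat \<Rightarrow> bool" where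
  "child x y a b \<longleftrightarrow> a \<in> stops x y \<and> b \<in> stops x y \<and>
     (a < b \<and> (\<forall>w \<in> stops x y. \<not> (a < w \<and> w < b)) \<or> a = b \<and> y = Suc (Suc x))"

text \<open>
  The intervals \<open>[x, y]\<close> of the nested subdivision, with their depth \<open>d\<close>.
\<close>

inductive frame :: "nat \<Rightarrow> nat \<Rightarrow> nat \<Rightarrow> bool" where
  root: "frame 0 0 (n - 1)"
| sub: "frame d x y \<Longrightarrow> child x y a b \<Longrightarrow> frame (Suc d) a b"

text \<open>
  Intervals are half-open here, so that two consecutive parts do not cover the same position; a
  one-point interval still covers its point.
\<close>

definition covers :: "nat \<Rightarrow> nat \<Rightarrow> nat \<Rightarrow> bool" where
  "covers t x y \<longleftrightarrow> x \<le> t \<and> (t < y \<or> t = x)"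

lemma finite_stops: "finite (stops x y)"
  by (rule finite_subset[of _ "{..<y}"]) (auto simp: stops_def)

lemma child_bounds: "child x y a b \<Longrightarrow> x < a \<and> a \<le> b \<and> b < y"
  by (auto simp: child_def stops_def)

lemma frame_bounds: "frame d x y \<Longrightarrow> x \<le> y \<and> y < n"
  by (induction rule: frame.induct) (use nonempty child_bounds in force)+

lemma frame_ancestor:
  assumes "frame e x y" "d < e"
  shows "\<exists>a b. frame d a b \<and> a < x \<and> y < b"
  using assms
proof (induction rule: frame.induct)
  case (sub e x y a b)
  note bounds = child_bounds[OF sub.hyps(2)]
  show ?case
  proof (cases "d = e")
    case True
    then show ?thesis
      using sub.hyps(1) bounds by blast
  next
    case False
    then have "d < e"
      using sub.prems by simp
    then obtain a' b' where "frame d a' b'" "a' < x" "y < b'"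
      using sub.IH by blast
    moreover from this bounds have "a' < a" "b < b'"
      by simp_all
    ultimately show ?thesis
      by blast
  qed
qed simp

lemma children_unique:
  assumes "child x y a b" "covers t a b" "child x y a' b'" "covers t a' b'"
  shows "a = a' \<and> b = b'"
proof (cases "y = Suc (Suc x)")
  case True
  then have "stops x y = {Suc x}"
    by (auto simp: stops_def)
  then show ?thesis
    using assms(1,3) by (auto simp: child_def)
next
  case False
  then have "a < b" "a' < b'" and in_stops: "a \<in> stops x y" "b \<in> stops x y" "a' \<in> stops x y" "b' \<in> stops x y"
      and gap: "\<And>w. w \<in> stops x y \<Longrightarrow> \<not> (a < w \<and> w < b)" "\<And>w. w \<in> stops x y \<Longrightarrow> \<not> (a' < w \<and> w < b')"
    using assms(1,3) unfolding child_def by blast+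
  moreover have "a \<le> t" "t < b" "a' \<le> t" "t < b'"
    using assms(2,4) \<open>a < b\<close> \<open>a' < b'\<close> by (auto simp: covers_def)
  ultimately show ?thesis
    using gap(1)[OF in_stops(3)] gap(1)[OF in_stops(4)] gap(2)[OF in_stops(1)] gap(2)[OF in_stops(2)]
    by linarith
qed

lemma covers_parent: "child x y a b \<Longrightarrow> covers t a b \<Longrightarrow> covers t x y"
  using child_bounds[of x y a b] by (auto simp: covers_def)

text \<open>
  The intervals of a given depth cover every position at most once. By induction, two that cover
  \<open>t\<close> are children of the same interval, and different children are disjoint as half-open
  intervals.
\<close>

lemma frame_unique:
  assumes "frame d x y" "covers t x y" "frame d x' y'" "covers t x' y'"
  shows "x = x' \<and> y = y'"
  using assms
proof (induction arbitrary: x' y' rule: frame.induct)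
  case root
  from root(2) show ?case
    by (cases rule: frame.cases) auto
next
  case (sub d x y a b)
  from sub.prems(2) obtain u v where uv: "frame d u v" "child u v x' y'"
    by (cases rule: frame.cases) auto
  have "x = u \<and> y = v"
    using sub.IH[OF covers_parent[OF sub.hyps(2) sub.prems(1)] uv(1) covers_parent[OF uv(2) sub.prems(3)]] .
  then show ?case
    using children_unique[OF sub.hyps(2) sub.prems(1) _ sub.prems(3)] uv(2) by blast
qed

lemma end_not_interior:
  assumes "frame d x y" "v \<in> {x, y}" "frame d a b"
  shows "\<not> (a < v \<and> v < b)"
proof
  assume ab: "a < v \<and> v < b"
  have "\<exists>t. covers t x y \<and> covers t a b"
  proof (cases "v = x")
    case True
    then show ?thesis
      using ab frame_bounds[OF assms(1)] by (intro exI[of _ v]) (auto simp: covers_def)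
  next
    case False
    then have "covers (v - 1) x y" "covers (v - 1) a b"
      using assms(2) ab frame_bounds[OF assms(1)] by (auto simp: covers_def)
    then show ?thesis
      by blast
  qed
  then show False
    using frame_unique[OF assms(1) _ assms(3)] assms(2) ab by auto
qed

text \<open>
  An interval has ancestors of every smaller depth, and its ends are strictly interior to them.
  But an end of an interval of depth \<open>d\<close> cannot be interior to another interval of depth \<open>d\<close>.
\<close>

lemma depth_unique:
  assumes "frame d x y" "v \<in> {x, y}" "frame e x' y'" "v \<in> {x', y'}"
  shows "d = e"
proof -
  have "\<not> d < e" if d: "frame d x y" "v \<in> {x, y}" and e: "frame e x' y'" "v \<in> {x', y'}" for d e x y x' y'
  proof
    assume "d < e"
    then obtain a b where "frame d a b" "a < x'" "y' < b"
      using frame_ancestor[OF e(1)] by blast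
    moreover from this have "a < v" "v < b"
      using e(2) frame_bounds[OF e(1)] by auto
    ultimately show False
      using end_not_interior[OF d] by blast
  qed
  then show ?thesis
    using assms linorder_neqE_nat by metis
qed

lemma child_between:
  assumes "a \<in> stops x y" "b \<in> stops x y" "a < b" "\<And>w. w \<in> stops x y \<Longrightarrow> \<not> (a < w \<and> w < b)"
  shows "child x y a b"
  using assms unfolding child_def by blast

lemma stop_in_child:
  assumes "z \<in> stops x y"
  shows "\<exists>a b. child x y a b \<and> z \<in> {a, b}"
proof (cases "y = Suc (Suc x)")
  case True
  then have "child x y z z"
    using assms by (simp add: child_def)
  then show ?thesis
    by blast
next
  case False
  have z: "x < z" "z < y"
    using assms by (auto simp: stops_def)
  show ?thesis
  proof (cases "Suc z = y")
    case True
    define a where "a = Max {w \<in> stops x y. w < z}"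
    have fin: "finite {w \<in> stops x y. w < z}"
      using finite_stops by simp
    have "Suc x \<in> {w \<in> stops x y. w < z}"
      using z False True by (auto simp: stops_def)
    then have a: "a \<in> stops x y" "a < z"
      using Max_in[OF fin] unfolding a_def by blast+
    have "w \<le> a" if "w \<in> stops x y" "w < z" for w
      using Max_ge[OF fin, of w] that by (simp add: a_def)
    then have "\<not> (a < w \<and> w < z)" if "w \<in> stops x y" for w
      using that leD by blast
    then have "child x y a z"
      by (intro child_between a assms)
    then show ?thesis
      by blast
  next
    case False
    define b where "b = Min {w \<in> stops x y. z < w}"
    have fin: "finite {w \<in> stops x y. z < w}"
      using finite_stops by simp
    have "y - 1 \<in> {w \<in> stops x y. z < w}"
      using z False by (auto simp: stops_def)
    then have b: "b \<in> stops x y" "z < b"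
      using Min_in[OF fin] unfolding b_def by blast+
    have "b \<le> w" if "w \<in> stops x y" "z < w" for w
      using Min_le[OF fin, of w] that by (simp add: b_def)
    then have "\<not> (z < w \<and> w < b)" if "w \<in> stops x y" for w
      using that leD by blast
    then have "child x y z b"
      by (intro child_between b assms)
    then show ?thesis
      by blast
  qed
qed

text \<open>
  The noncrossing property enters here: a stop strictly between \<open>u\<close> and \<open>v\<close> would be joined to \<open>x\<close>
  or to \<open>y\<close> by an edge that crosses \<open>uv\<close>.
\<close>

lemma pair_in_child:
  assumes uv: "x < u" "u \<le> v" "v < y" and "y < n" and "u = v \<or> A u v"
  shows "\<exists>a b. child x y a b \<and> a \<le> u \<and> v \<le> b"
proof -
  define a where "a = Max {w \<in> stops x y. w \<le> u}"
  define b where "b = Min {w \<in> stops x y. v \<le> w}"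
  have fin: "finite {w \<in> stops x y. w \<le> u}" "finite {w \<in> stops x y. v \<le> w}"
    using finite_stops by simp_all
  have "Suc x \<in> {w \<in> stops x y. w \<le> u}" "y - 1 \<in> {w \<in> stops x y. v \<le> w}"
    using uv by (auto simp: stops_def)
  then have a: "a \<in> stops x y" "a \<le> u" and b: "b \<in> stops x y" "v \<le> b"
    using Max_in[OF fin(1)] Min_in[OF fin(2)] unfolding a_def b_def by blast+
  show ?thesis
  proof (cases "a < b")
    case True
    have "\<not> (a < w \<and> w < b)" if w: "w \<in> stops x y" for w
    proof
      assume ab: "a < w \<and> w < b"
      have "w \<le> a" if "w \<le> u"
        using Max_ge[OF fin(1), of w] w that by (simp add: a_def)
      moreover have "b \<le> w" if "v \<le> w"
        using Min_le[OF fin(2), of w] w that by (simp add: b_def)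
      ultimately have "u < w" "w < v"
        using ab by (meson leD not_le)+
      then have "A u v" "A x w \<or> A w y"
        using assms w by (auto simp: stops_def)
      then show False
        using noncross[of x u w v] noncross[of u w v y] \<open>u < w\<close> \<open>w < v\<close> assms(4) uv by auto
    qed
    then have "child x y a b"
      using child_between[OF a(1) b(1) True] by blast
    then show ?thesis
      using a b by blast
  next
    case False
    then have "u = a" "v = a" "a = b"
      using a b uv by simp_all
    then show ?thesis
      using stop_in_child[OF a(1)] child_bounds by fastforce
  qed
qed

text \<open>
  Take an interval of least length that contains \<open>u\<close> and \<open>v\<close>; if both were interior, a child would
  be shorter.
\<close>

lemma smallest_frame:
  assumes "u \<le> v" "v < n" "u = v \<or> A u v"
  shows "\<exists>d x y. frame d x y \<and> x \<le> u \<and> v \<le> y \<and> (u = x \<or> v = y)"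
proof -
  let ?P = "\<lambda>(d, x, y). frame d x y \<and> x \<le> u \<and> v \<le> y"
  have "?P (0, 0, n - 1)"
    using assms(2) root by simp
  then obtain f where f: "?P f" "\<And>g. ?P g \<Longrightarrow> (\<lambda>(d, x, y). y - x) f \<le> (\<lambda>(d, x, y). y - x) g"
    using ex_has_least_nat[of ?P _ "\<lambda>(d, x, y). y - x"] by blast
  obtain d x y where [simp]: "f = (d, x, y)"
    by (cases f)
  have fr: "frame d x y" "x \<le> u" "v \<le> y"
    using f(1) by simp_all
  have "u = x \<or> v = y"
  proof (rule ccontr)
    assume "\<not> ?thesis"
    then have "x < u" "v < y" "y < n"
      using fr frame_bounds by auto
    then obtain a b where ab: "child x y a b" "a \<le> u" "v \<le> b"
      using pair_in_child[of x u v y] assms by blast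
    then have "frame (Suc d) a b"
      using fr(1) by (auto intro: sub)
    then have "y - x \<le> b - a"
      using f(2)[of "(Suc d, a, b)"] ab by simp
    then show False
      using child_bounds[OF ab(1)] by linarith
  qed
  then show ?thesis
    using fr by blast
qed

definition bag :: "nat \<Rightarrow> nat set" where
  "bag t = {v. \<exists>d x y. frame d x y \<and> covers t x y \<and> v \<in> {x, y}}"

text \<open>
  By \<open>depth_unique\<close> the choice is unique, and by \<open>smallest_frame\<close> it is possible for every vertex.
\<close>

definition depth :: "nat \<Rightarrow> nat" where
  "depth v = (SOME d. \<exists>x y. frame d x y \<and> v \<in> {x, y})"

lemma depth_eq:
  assumes "frame d x y" "v \<in> {x, y}"
  shows "depth v = d"
proof -
  have "\<exists>x y. frame (depth v) x y \<and> v \<in> {x, y}"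
    unfolding depth_def by (rule someI_ex) (use assms in blast)
  then show ?thesis
    using depth_unique assms by blast
qed

lemma covers_left: "covers x x y"
  by (simp add: covers_def)

lemma bag_index: "v \<in> bag t \<Longrightarrow> t < n \<and> v < n"
  using frame_bounds by (fastforce simp: bag_def covers_def)

lemma in_some_bag: "v < n \<Longrightarrow> \<exists>t. v \<in> bag t"
  using smallest_frame[of v v] covers_left by (fastforce simp: bag_def)

text \<open>
  To the left of \<open>v\<close> the bag membership of \<open>v\<close> comes from intervals with right end \<open>v\<close>, and from
  \<open>v\<close> on from intervals with left end \<open>v\<close>. Such an interval also covers all positions between \<open>t\<close>
  or \<open>t'\<close> and \<open>v\<close>.
\<close>

lemma bag_convex:
  assumes t: "v \<in> bag t" and t': "v \<in> bag t'" and "t \<le> s" "s \<le> t'"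
  shows "v \<in> bag s"
proof (cases "s < v")
  case True
  obtain d x y where f: "frame d x y" "covers t x y" "v \<in> {x, y}"
    using t by (auto simp: bag_def)
  then have "covers s x y"
    using True \<open>t \<le> s\<close> by (auto simp: covers_def)
  then show ?thesis
    using f by (auto simp: bag_def)
next
  case False
  obtain d x y where f: "frame d x y" "covers t' x y" "v \<in> {x, y}"
    using t' by (auto simp: bag_def)
  then have "covers s x y"
    using False \<open>s \<le> t'\<close> frame_bounds[OF f(1)] by (auto simp: covers_def)
  then show ?thesis
    using f by (auto simp: bag_def)
qed

lemma bag_interval:
  assumes "v < n"
  shows "\<exists>i j. i \<le> j \<and> j < n \<and> {t. t < n \<and> v \<in> bag t} = {i..j}"
proof -
  let ?T = "{t. t < n \<and> v \<in> bag t}"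
  have fin: "finite ?T" and ne: "?T \<noteq> {}"
    using in_some_bag[OF assms] bag_index by auto
  have ends: "Min ?T \<in> ?T" "Max ?T \<in> ?T"
    using Min_in[OF fin ne] Max_in[OF fin ne] .
  have "?T = {Min ?T..Max ?T}"
  proof
    show "?T \<subseteq> {Min ?T..Max ?T}"
      using Min_le[OF fin] Max_ge[OF fin] by auto
    show "{Min ?T..Max ?T} \<subseteq> ?T"
    proof
      fix s assume "s \<in> {Min ?T..Max ?T}"
      then show "s \<in> ?T"
        using bag_convex[of v "Min ?T" "Max ?T" s] ends bag_index by auto
    qed
  qed
  moreover have "Min ?T \<le> Max ?T"
    using Min_le[OF fin ends(2)] .
  ultimately show ?thesis
    using ends(2) by blast
qed

text \<open>
  In the smallest interval around an edge, one end of the edge is an end of the interval. The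
  other one is either the other end, at the same depth, or a stop, which is an end of a child and
  so one level deeper.
\<close>

lemma edge_depth_and_bag:
  assumes "A u v" "u < v" "v < n"
  shows "depth u \<le> Suc (depth v) \<and> depth v \<le> Suc (depth u) \<and> (\<exists>t. u \<in> bag t \<and> v \<in> bag t)"
proof -
  obtain d x y where f: "frame d x y" "x \<le> u" "v \<le> y" "u = x \<or> v = y"
    using smallest_frame[of u v] assms by auto
  show ?thesis
  proof (cases "u = x \<and> v = y")
    case True
    then have "u \<in> bag x" "v \<in> bag x" "depth u = d" "depth v = d"
      using f(1) covers_left depth_eq[OF f(1)] unfolding bag_def by blast+
    then show ?thesis
      by auto
  next
    case False
    \<comment> \<open>The end \<open>w\<close> of the edge is an end of the interval, and \<open>z\<close> is a stop.\<close>
    define z w where "z = (if u = x then v else u)" and "w = (if u = x then u else v)"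
    have "z \<in> stops x y"
      using f False assms sym by (auto simp: stops_def z_def)
    then obtain a b where ab: "child x y a b" "z \<in> {a, b}"
      using stop_in_child by blast
    then have f': "frame (Suc d) a b"
      using f(1) by (auto intro: sub)
    have "w \<in> {x, y}"
      using f(4) by (auto simp: w_def)
    moreover have "covers a x y"
      using covers_parent[OF ab(1) covers_left] .
    ultimately have "w \<in> bag a" "z \<in> bag a" "depth w = d" "depth z = Suc d"
      using f(1) f' ab(2) covers_left depth_eq[OF f(1)] depth_eq[OF f'] unfolding bag_def by blast+
    moreover have "{u, v} = {w, z}"
      by (auto simp: w_def z_def)
    ultimately show ?thesis
      by (auto simp: doubleton_eq_iff)
  qed
qed

lemma bag_depth_card: "card {v \<in> bag t. depth v = d} \<le> 2"
proof (cases "\<exists>x y. frame d x y \<and> covers t x y")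
  case True
  then obtain x y where f: "frame d x y" "covers t x y"
    by blast
  have "{v \<in> bag t. depth v = d} \<subseteq> {x, y}"
  proof
    fix v assume "v \<in> {v \<in> bag t. depth v = d}"
    then obtain e a b where e: "frame e a b" "covers t a b" "v \<in> {a, b}" "depth v = d"
      by (auto simp: bag_def)
    then have "e = d"
      using depth_eq by blast
    then show "v \<in> {x, y}"
      using frame_unique[OF f] e by auto
  qed
  then have "card {v \<in> bag t. depth v = d} \<le> card {x, y}"
    by (intro card_mono) auto
  also have "\<dots> \<le> 2"
    by (simp add: card_insert_if)
  finally show ?thesis .
next
  case False
  have "depth v \<noteq> d" if "v \<in> bag t" for v
  proof -
    obtain e a b where e: "frame e a b" "covers t a b" "v \<in> {a, b}"
      using \<open>v \<in> bag t\<close> by (auto simp: bag_def)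
    then have "depth v = e"
      using depth_eq by blast
    then show ?thesis
      using e False by blast
  qed
  then have empty: "{v \<in> bag t. depth v = d} = {}"
    by blast
  show ?thesis
    unfolding empty by simp
qed

text \<open>
  Layers have to be nonempty; no depth is skipped because intervals have ancestors of all smaller
  depths.
\<close>

lemma depths_initial: "\<exists>m. \<forall>d. (\<exists>v < n. depth v = d) \<longleftrightarrow> d < m"
proof -
  define m where "m = Suc (Max (depth ` {..<n}))"
  have "\<exists>v < n. depth v = d" if "d < m" for d
  proof -
    have "Max (depth ` {..<n}) \<in> depth ` {..<n}"
      using nonempty by (intro Max_in) auto
    then obtain v where "v < n" "Max (depth ` {..<n}) = depth v"
      by auto
    then have v: "v < n" "d \<le> depth v"
      using that by (simp_all add: m_def)
    obtain e x y where f: "frame e x y" "v \<in> {x, y}"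
      using smallest_frame[of v v] v(1) by auto
    then have "d \<le> e"
      using depth_eq v(2) by blast
    then have "\<exists>a b. frame d a b"
      using f(1) frame_ancestor[OF f(1), of d] by (cases "d = e") auto
    then obtain a b where "frame d a b"
      by blast
    then have "a < n" "depth a = d"
      using frame_bounds depth_eq by force+
    then show ?thesis
      by blast
  qed
  moreover have "depth v < m" if "v < n" for v
    using that by (simp add: m_def less_Suc_eq_le)
  ultimately show ?thesis
    by blast
qed

end


lemma increasing_enumeration:
  fixes f :: "'a \<Rightarrow> nat"
  assumes "finite W" "inj_on f W"
  obtains vs where "set vs = W" "sorted_wrt (\<lambda>u v. f u < f v) vs"
proof -
  define vs where "vs = map (the_inv_into W f) (sorted_list_of_set (f ` W))"
  have inv: "f (the_inv_into W f k) = k" if "k \<in> f ` W" for k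
    using f_the_inv_into_f[OF assms(2) that] .
  have "set vs = W"
    using assms by (simp add: vs_def image_image the_inv_into_f_f)
  moreover have "sorted_wrt (\<lambda>u v. f u < f v) vs"
    unfolding vs_def sorted_wrt_map
    by (rule sorted_wrt_mono_rel[OF _ strict_sorted_list_of_set]) (use assms(1) inv in auto)
  ultimately show ?thesis
    using that by blast
qed

lemma layered_decomposition_of_order:
  fixes G :: "'a pair_pre_digraph"
  defines "E \<equiv> \<lambda>u v. (u, v) \<in> parcs G"
  assumes verts: "distinct vs" "set vs = pverts G" "vs \<noteq> []"
    and E_sym: "\<And>u v. E u v \<Longrightarrow> E v u" and irrefl: "\<And>v. \<not> E v v"
    and wf: "\<And>u v. E u v \<Longrightarrow> u \<in> pverts G \<and> v \<in> pverts G"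
    and noncross: "\<And>i j k l. \<lbrakk>i < j; j < k; k < l; l < length vs; E (vs ! i) (vs ! k)\<rbrakk> \<Longrightarrow> \<not> E (vs ! j) (vs ! l)"
  shows "\<exists>Bs Ls. path_decomposition G Bs \<and> layering G Ls \<and>
    (\<forall>B \<in> set Bs. \<forall>L \<in> set Ls. card (B \<inter> L) \<le> 2)"
proof -
  let ?n = "length vs"
  interpret noncrossing_graph_order "\<lambda>i j. E (vs ! i) (vs ! j)" ?n
    using E_sym noncross verts(3) by unfold_locales auto
  obtain m where m: "\<And>d. (\<exists>v < ?n. depth v = d) \<longleftrightarrow> d < m"
    using depths_initial by blast
  have inj: "inj_on ((!) vs) {..<?n}"
    using verts(1) by (simp add: inj_on_nth)
  define Bs where "Bs = map (\<lambda>t. (!) vs ` bag t) [0..<?n]"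
  define lay where "lay d = (!) vs ` {v. v < ?n \<and> depth v = d}" for d
  define Ls where "Ls = map lay [0..<m]"
  have index: "\<exists>i < ?n. vs ! i = v" if "v \<in> pverts G" for v
    using that verts(2) by (metis in_set_conv_nth)
  have in_bag: "vs ! i \<in> Bs ! t \<longleftrightarrow> i \<in> bag t" if "i < ?n" "t < ?n" for i t
    using that bag_index[of _ t] nth_eq_iff_index_eq[OF verts(1)] by (auto simp: Bs_def)
  have in_lay: "vs ! i \<in> lay d \<longleftrightarrow> depth i = d" if "i < ?n" for i d
    using that nth_eq_iff_index_eq[OF verts(1)] by (auto simp: lay_def)
  have edge_index: "\<exists>i j. i < j \<and> j < ?n \<and> {u, v} = {vs ! i, vs ! j} \<and> E (vs ! i) (vs ! j)"
    if uv: "E u v" for u v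
  proof -
    obtain i j where ij: "i < ?n" "vs ! i = u" "j < ?n" "vs ! j = v"
      using index wf[OF uv] by blast
    moreover have "i \<noteq> j"
      using ij uv irrefl by auto
    ultimately show ?thesis
      using uv E_sym[OF uv] by (metis insert_commute linorder_neqE_nat)
  qed
  have "path_decomposition G Bs"
    unfolding path_decomposition_def
  proof (intro conjI ballI)
    fix B assume "B \<in> set Bs"
    then show "B \<subseteq> pverts G"
      using bag_index verts(2) by (fastforce simp: Bs_def)
  next
    fix v assume "v \<in> pverts G"
    then obtain k where k: "k < ?n" "vs ! k = v"
      using index by blast
    obtain i j where "i \<le> j" "j < ?n" "{t. t < ?n \<and> k \<in> bag t} = {i..j}"
      using bag_interval[OF k(1)] by blast
    moreover have "{t. t < length Bs \<and> v \<in> Bs ! t} = {t. t < ?n \<and> k \<in> bag t}"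
      using in_bag[OF k(1)] k(2) by (auto simp: Bs_def)
    ultimately show "\<exists>i j. i \<le> j \<and> j < length Bs \<and> {t. t < length Bs \<and> v \<in> Bs ! t} = {i..j}"
      by (auto simp: Bs_def)
  next
    fix e assume "e \<in> edges G"
    then obtain u v where "e = {u, v}" "E u v"
      by (auto simp: edges_def E_def)
    then obtain i j where ij: "i < j" "j < ?n" "e = {vs ! i, vs ! j}" "E (vs ! i) (vs ! j)"
      using edge_index by blast
    then obtain t where t: "i \<in> bag t" "j \<in> bag t"
      using edge_depth_and_bag by blast
    then have "e \<subseteq> Bs ! t" "t < length Bs"
      using in_bag ij bag_index[OF t(1)] by (auto simp: Bs_def)
    then show "\<exists>B \<in> set Bs. e \<subseteq> B"
      using nth_mem by blast
  qed
  moreover have "layering G Ls"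
    unfolding layering_def
  proof (intro conjI allI impI)
    have ne: "lay d \<noteq> {}" if "d < m" for d
      using m[of d] that by (auto simp: lay_def)
    have disj: "lay d \<inter> lay d' = {}" if "d \<noteq> d'" for d d'
      using in_lay that by (fastforce simp: lay_def)
    have inj_lay: "inj_on lay {0..<m}"
      using ne disj by (intro inj_onI) (metis Int_absorb atLeastLessThan_iff)
    show "partition_on (pverts G) (set Ls)"
    proof (rule partition_onI)
      show "\<Union> (set Ls) = pverts G"
      proof
        show "\<Union> (set Ls) \<subseteq> pverts G"
          unfolding Ls_def lay_def verts(2)[symmetric] by auto
        show "pverts G \<subseteq> \<Union> (set Ls)"
        proof
          fix v assume "v \<in> pverts G"
          then obtain k where k: "k < ?n" "vs ! k = v"
            using index by blast
          then have "depth k < m" "v \<in> lay (depth k)"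
            using m[of "depth k"] in_lay[of k "depth k"] by auto
          then show "v \<in> \<Union> (set Ls)"
            unfolding Ls_def by auto
        qed
      qed
    next
      fix P Q assume "P \<in> set Ls" "Q \<in> set Ls" "P \<noteq> Q"
      then obtain d d' where "P = lay d" "Q = lay d'" "d \<noteq> d'"
        by (auto simp: Ls_def)
      then show "disjnt P Q"
        using disj[of d d'] by (simp add: disjnt_def)
    next
      show "{} \<notin> set Ls"
      proof
        assume "{} \<in> set Ls"
        then obtain d where "d < m" "lay d = {}"
          by (auto simp: Ls_def)
        then show False
          using ne by blast
      qed
    qed
    show "distinct Ls"
      using inj_lay by (simp add: Ls_def distinct_map)
    fix u v i j
    assume uv: "{u, v} \<in> edges G" "i < length Ls" "j < length Ls" "u \<in> Ls ! i" "v \<in> Ls ! j"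
    then have "u \<in> lay i" "v \<in> lay j"
      by (simp_all add: Ls_def)
    then obtain a b where ab: "a < ?n" "vs ! a = u" "depth a = i" "b < ?n" "vs ! b = v" "depth b = j"
      unfolding lay_def by blast
    have "E u v"
      using uv(1) E_sym by (auto simp: edges_def E_def doubleton_eq_iff)
    moreover from this have "a \<noteq> b"
      using irrefl ab by auto
    ultimately have "depth a \<le> Suc (depth b) \<and> depth b \<le> Suc (depth a)"
      using edge_depth_and_bag[of a b] edge_depth_and_bag[of b a] ab E_sym by (metis linorder_neqE_nat)
    then show "i \<le> Suc j" "j \<le> Suc i"
      using ab by simp_all
  qed
  moreover have "card (B \<inter> L) \<le> 2" if BL: "B \<in> set Bs" "L \<in> set Ls" for B L
  proof -
    obtain t d where td: "t < ?n" "B = (!) vs ` bag t" "L = lay d"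
      using BL by (auto simp: Bs_def Ls_def)
    have "B \<inter> L \<subseteq> (!) vs ` {v \<in> bag t. depth v = d}"
      using td bag_index in_lay by fastforce
    moreover have fin: "finite {v \<in> bag t. depth v = d}"
      by (rule finite_subset[of _ "{..<?n}"]) (use bag_index in auto)
    ultimately have "card (B \<inter> L) \<le> card ((!) vs ` {v \<in> bag t. depth v = d})"
      by (intro card_mono) auto
    also have "\<dots> \<le> card {v \<in> bag t. depth v = d}"
      by (rule card_image_le[OF fin])
    also have "\<dots> \<le> 2"
      by (rule bag_depth_card)
    finally show ?thesis .
  qed
  ultimately show ?thesis
    by blast
qed


section \<open>Outerplanar graphs\<close>

theorem corollary16:
  fixes G :: "'a pair_pre_digraph"
  assumes "pair_graph G" and "outerplanar G"
  shows "layered_pathwidth G \<le> 2"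
proof -
  obtain p \<gamma> where "plane_drawing G p \<gamma>" "p ` pverts G \<subseteq> frontier (outside (drawing_points G p \<gamma>))"
    using assms(2) unfolding outerplanar_def by blast
  then interpret outerplane_drawing G p \<gamma>
    by (rule outerplane_drawing.intro[OF assms(1)])
  interpret theta_chord_free adj
  proof
    show "adj a b \<Longrightarrow> adj b a" for a b
      by (rule adj_sym)
    show "q = [] \<or> r = [] \<or> s = []"
      if "successively adj (x # q @ [y])" "successively adj (x # r @ [y])"
        "successively adj (x # s @ [y])" "distinct (x # y # q @ r @ s)" for x q y r s
      using that by (rule no_three_paths)
    show False
      if "successively adj (a # q1 @ b # q2 @ c # q3 @ d # q4 @ [a])"
        "distinct (a # q1 @ b # q2 @ c # q3 @ d # q4)" "adj a c" "adj b d" for a q1 b q2 c q3 d q4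
      using that by (rule no_crossing_chords)
  qed
  obtain f where f: "noncrossing (pverts G) adj f"
    using noncrossing_order_exists[OF finite_verts] by blast
  then have "inj_on f (pverts G)"
    by (simp add: noncrossing_def)
  then obtain vs where vs: "set vs = pverts G" "sorted_wrt (\<lambda>u v. f u < f v) vs"
    using increasing_enumeration finite_verts by blast
  have "sorted_wrt (<) (map f vs)"
    using vs(2) by (simp add: sorted_wrt_map)
  then have "distinct (map f vs)"
    by (simp add: strict_sorted_iff)
  then have dist: "distinct vs"
    by (simp add: distinct_map)
  have noncross: "\<not> adj (vs ! j) (vs ! l)"
    if "i < j" "j < k" "k < l" "l < length vs" "adj (vs ! i) (vs ! k)" for i j k l
  proof -
    have "f (vs ! i) < f (vs ! j)" "f (vs ! j) < f (vs ! k)" "f (vs ! k) < f (vs ! l)"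
      using sorted_wrt_nth_less[OF vs(2)] that by simp_all
    moreover have "vs ! i \<in> pverts G" "vs ! j \<in> pverts G" "vs ! k \<in> pverts G" "vs ! l \<in> pverts G"
      unfolding vs(1)[symmetric] using that by simp_all
    ultimately show ?thesis
      using noncrossingD[OF f] that(5) by blast
  qed
  have "\<exists>Bs Ls. path_decomposition G Bs \<and> layering G Ls \<and>
      (\<forall>B \<in> set Bs. \<forall>L \<in> set Ls. card (B \<inter> L) \<le> 2)"
  proof (cases "vs = []")
    case True
    then have "pverts G = {}"
      using vs(1) by simp
    moreover from this have "edges G = {}"
      using adj_verts by (auto simp: edges_def)
    ultimately have "path_decomposition G []" "layering G []"
      by (simp_all add: path_decomposition_def layering_def partition_on_def)
    then show ?thesis
      by fastforce
  next
    case False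
    show ?thesis
    proof (rule layered_decomposition_of_order[OF dist vs(1) False])
      show "adj v u" if "adj u v" for u v
        using that by (rule adj_sym)
      show "\<not> adj v v" for v
        by (rule adj_irrefl)
      show "u \<in> pverts G \<and> v \<in> pverts G" if "adj u v" for u v
        using that by (rule adj_verts)
      show "\<not> adj (vs ! j) (vs ! l)"
        if "i < j" "j < k" "k < l" "l < length vs" "adj (vs ! i) (vs ! k)" for i j k l
        using that by (rule noncross)
    qed
  qed
  then show ?thesis
    unfolding layered_pathwidth_def by (rule Least_le)
qed

end
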